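(* Let $k\ge1$ and let $f_1,f_2,\ldots,f_k$ be transcendental entire functions of order less than $\frac12$. Suppose that, for some $j\in\{1,2,\ldots,k\}$, $f_j$ is log-regular. Let $g=f_1\circ f_2\circ\cdots\circ f_k$. Then every component of the Fatou set $F(g)$ is bounded.
   Context: For an entire function $f$ put $M(r,f)=\max_{|z|=r}|f(z)|$ for $r>0$. The order of a transcendental entire function $f$ is $\rho(f)=\limsup_{r\to\infty}\frac{\log\log M(r,f)}{\log r}$. The Fatou set $F(f)$ is the set of $z\in\mathbb C$ such that the iterates $(f^n)_{n\ge1}$ form a normal family in a neighbourhood of $z$. A transcendental entire function $f$ is log-regular (with constant $c>0$) if $\phi(t)=\log M(e^t,f)$ satisfies $\phi'(t)/\phi(t)\ge (1+c)/t$ for all large $t$; it is log-regular if this holds for some $c>0$. (Since $\phi$ is convex, $\phi'$ exists outside a countable set; at exceptional points $\phi'$ is read as the right derivative.) *)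

theory Defs
  imports "HOL-Complex_Analysis.Complex_Analysis" "HOL-Computational_Algebra.Polynomial"
begin

definition transcendental_entire :: "(complex \<Rightarrow> complex) \<Rightarrow> bool" where
  "transcendental_entire f \<longleftrightarrow> f holomorphic_on UNIV \<and> \<not> (\<exists>p :: complex poly. \<forall>z. f z = poly p z)"

text \<open>For continuous \<open>f\<close> and \<open>r > 0\<close> the supremum is attained, since the circle is compact.\<close>
definition max_modulus :: "(complex \<Rightarrow> complex) \<Rightarrow> real \<Rightarrow> real" where
  "max_modulus f r = (SUP z\<in>sphere 0 r. norm (f z))"

text \<open>The order may be infinite, hence the extended reals.\<close>
definition growth_order :: "(complex \<Rightarrow> complex) \<Rightarrow> ereal" where
  "growth_order f = Limsup at_top (\<lambda>r :: real. ereal (ln (ln (max_modulus f r)) / ln r))"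

definition log_max_modulus_exp :: "(complex \<Rightarrow> complex) \<Rightarrow> real \<Rightarrow> real" where
  "log_max_modulus_exp f t = ln (max_modulus f (exp t))"

text \<open>
  Since \<open>log_max_modulus_exp f\<close> is convex for a nonzero entire \<open>f\<close>, its right derivative \<open>D\<close>
  exists at every point, is unique, and is the derivative wherever the latter exists.
\<close>
definition log_regular_with :: "real \<Rightarrow> (complex \<Rightarrow> complex) \<Rightarrow> bool" where
  "log_regular_with c f \<longleftrightarrow> c > 0 \<and> transcendental_entire f \<and>
     (\<forall>\<^sub>F t in at_top. \<exists>D. (log_max_modulus_exp f has_real_derivative D) (at_right t) \<and>
        D / log_max_modulus_exp f t \<ge> (1 + c) / t)"

definition log_regular :: "(complex \<Rightarrow> complex) \<Rightarrow> bool" where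
  "log_regular f \<longleftrightarrow> (\<exists>c>0. log_regular_with c f)"

text \<open>
  Normality in the sense of Montel, with \<open>\<infinity>\<close> admitted as a limit: every sequence from the family
  has a subsequence that converges, uniformly on compact subsets of \<open>U\<close>, either to a finite
  function (holomorphic when the family is) or to \<open>\<infinity>\<close>. For holomorphic functions on a domain
  \<open>U\<close> this is normality with respect to the spherical metric.
\<close>
definition normal_family_on :: "complex set \<Rightarrow> (complex \<Rightarrow> complex) set \<Rightarrow> bool" where
  "normal_family_on U \<F> \<longleftrightarrow>
     (\<forall>s :: nat \<Rightarrow> complex \<Rightarrow> complex. range s \<subseteq> \<F> \<longrightarrow>
        (\<exists>r :: nat \<Rightarrow> nat. strict_mono r \<and>
           ((\<exists>h. \<forall>K. compact K \<and> K \<subseteq> U \<longrightarrow> uniform_limit K (s \<circ> r) h sequentially) \<or>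
            (\<forall>K. compact K \<and> K \<subseteq> U \<longrightarrow>
               (\<forall>B. \<forall>\<^sub>F n in sequentially. \<forall>z\<in>K. norm (s (r n) z) > B)))))"

definition Fatou_set :: "(complex \<Rightarrow> complex) \<Rightarrow> complex set" where
  "Fatou_set f = {z. \<exists>U. open U \<and> connected U \<and> z \<in> U \<and> normal_family_on U {f ^^ n |n. n \<ge> 1}}"

end

theory Submission
  imports Defs "HOL-Real_Asymp.Real_Asymp"
begin

text \<open>
  Let \<open>M(r)\<close> denote the maximum modulus. On a disc, an entire function of order less than \<open>1/2\<close>
  is, up to a factor as close to \<open>1\<close> as desired, a constant times a finite product over zeros.
  Rotating all zeros to the positive axis can only decrease the minimum modulus on a circle and
  increase the maximum modulus, and for such products a maximum principle on a slit disc shows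
  that some circle with radius in \<open>[r, r\<^sup>m]\<close> has minimum modulus at least \<open>M(r)\<close>.

  Hence a continuum joining \<open>|z| = r\<close> to \<open>|z| = r\<^sup>L\<close> is mapped by each \<open>f\<^sub>i\<close> to one joining
  \<open>|z| \<le> s\<close> to \<open>|z| \<ge> s\<^sup>H\<close> with \<open>H = L/K\<close>, and even with \<open>H = (L/K)\<^sup>1\<^sup>+\<^sup>c\<close> if \<open>f\<^sub>i\<close> is log-regular.
  If \<open>L\<close> is large, the exponents therefore tend to infinity under iteration of \<open>g\<close>. An unbounded
  Fatou component contains such a continuum, so along a subsequence the iterates tend to infinity
  on it, and Harnack's inequality for the positive harmonic functions \<open>log |g\<^sup>n|\<close> bounds the exponents.
\<close>

text \<open>Each factor may divide the exponent by a constant, so without a gain the exponents could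
  be used up under iteration. The power \<open>1 + c\<close> of a single log-regular factor
  outweighs all losses of one application of \<open>g\<close> once the exponent is large, wherever
  that factor stands. Exponents are measured against an inner radius that bounds the orbit of one
  fixed point, since the contradiction compares \<open>ln |g^n|\<close> at that point with its size
  elsewhere on the continuum. Only finitely many zeros are ever split off, and the constants in the
  estimates for them do not depend on which zeros are chosen; so the finite set may change with the
  radius and no infinite product is formed. The order enters through the outer radius
  \<open>R = r powr m\<close>: growth of size \<open>K * R powr \<beta>\<close> on the outer circle
  counts near radius \<open>r\<close> only with weight of order \<open>sqrt (r / R)\<close>, and for
  \<open>\<beta> < 1 / 2\<close> a large \<open>m\<close> makes the product of the two
  small.\<close>

section \<open>Borel-Caratheodory and Harnack inequalities\<close>

text \<open>The Moebius map \<open>v / (2 * A - v)\<close> sends the half-plane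
  \<open>Re v < A\<close> into the unit disc and fixes 0, so the Schwarz lemma applies to
  \<open>F\<close>. Solving \<open>|u| \<le> |z| / R * (2 * A + |u|)\<close> for \<open>|u|\<close>
  gives the bound.\<close>

lemma borel_caratheodory:
  assumes hol: "u holomorphic_on ball 0 R" and u0: "u 0 = 0" and R: "0 < R"
    and A: "\<And>z. norm z < R \<Longrightarrow> Re (u z) < A" and z: "norm z < R"
  shows "norm (u z) \<le> 2 * A * norm z / (R - norm z)"
proof -
  have A0: "A > 0"
    using A[of 0] u0 R by simp
  define F where "F w = u (of_real R * w) / (2 * of_real A - u (of_real R * w))" for w
  have dom: "norm (of_real R * w) < R" if "norm w < 1" for w :: complex
    using that R by (simp add: norm_mult)
  have less: "norm (u v) < norm (2 * of_real A - u v)" if "norm v < R" for v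
  proof -
    have "(norm (u v))\<^sup>2 < (norm (2 * of_real A - u v))\<^sup>2"
      unfolding cmod_power2 using mult_strict_left_mono[OF A[OF that], of "4 * A"] A0
      by (simp add: power2_eq_square algebra_simps)
    then show ?thesis
      by (rule power_less_imp_less_base) simp
  qed
  have nz: "2 * of_real A - u v \<noteq> 0" if "norm v < R" for v
    using less[OF that] by auto
  have holc: "(\<lambda>w. u (of_real R * w)) holomorphic_on ball 0 1"
    using dom by (intro holomorphic_on_compose_gen[OF _ hol, unfolded o_def] holomorphic_intros) auto
  have Fhol: "F holomorphic_on ball 0 1"
    unfolding F_def using nz dom by (intro holomorphic_intros holc) auto
  have F1: "norm (F w) < 1" if "norm w < 1" for w
    using less[OF dom[OF that]] by (auto simp: F_def norm_divide divide_simps)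
  define w where "w = z / of_real R"
  have w: "norm w < 1" "of_real R * w = z" "norm w = norm z / R"
    using R z by (auto simp: w_def norm_divide)
  have "norm (F w) \<le> norm w"
    by (rule Schwarz_Lemma(1)[OF Fhol _ F1 w(1)]) (auto simp: F_def u0)
  then have "norm (u z) \<le> norm z / R * norm (2 * of_real A - u z)"
    using less[OF z] by (auto simp: F_def w norm_divide divide_simps split: if_splits)
  also have "\<dots> \<le> norm z / R * (2 * A + norm (u z))"
    using R A0 norm_triangle_ineq4[of "2 * of_real A" "u z"]
    by (intro mult_left_mono) (auto simp: norm_mult)
  finally show ?thesis
    using R z by (simp add: field_simps)
qed

text \<open>\<open>ln |s|\<close> is the real part of a logarithm \<open>h\<close>, and its
  positivity is the one-sided bound \<open>Re (h z0 - h z) < Re (h z0)\<close> that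
  Borel-Caratheodory asks for. Within half the radius the change is at most twice the central value,
  whence the 3.\<close>

lemma harnack:
  assumes hol: "s holomorphic_on ball z0 R" and R: "0 < R"
    and s: "\<And>z. z \<in> ball z0 R \<Longrightarrow> 1 < norm (s z)" and z: "dist z0 z \<le> R / 2"
  shows "ln (norm (s z)) \<le> 3 * ln (norm (s z0))"
proof -
  have nz: "\<forall>z\<in>ball z0 R. s z \<noteq> 0"
    using s by force
  obtain h where h: "h holomorphic_on ball z0 R" "\<And>z. z \<in> ball z0 R \<Longrightarrow> exp (h z) = s z"
    using holomorphic_logarithm_exists[OF convex_ball open_ball hol, of z0] nz R by auto
  have ln: "ln (norm (s z)) = Re (h z)" if "z \<in> ball z0 R" for z
    using h(2)[OF that, symmetric] by simp
  define u where "u w = h z0 - h (z0 + w)" for w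
  have dom: "norm w < R \<Longrightarrow> z0 + w \<in> ball z0 R" for w
    by (simp add: dist_norm)
  have "norm (u (z - z0)) \<le> 2 * Re (h z0) * norm (z - z0) / (R - norm (z - z0))"
  proof (rule borel_caratheodory[where R = R])
    show "u holomorphic_on ball 0 R"
      unfolding u_def
      by (intro holomorphic_intros holomorphic_on_compose_gen[OF _ h(1), unfolded o_def])
        (auto simp: dist_norm)
    show "Re (u w) < Re (h z0)" if "norm w < R" for w
      using ln_gt_zero[OF s[OF dom[OF that]]] ln[OF dom[OF that]] by (simp add: u_def)
  qed (use R z in \<open>auto simp: u_def dist_norm norm_minus_commute\<close>)
  also have "\<dots> \<le> 2 * Re (h z0)"
  proof -
    have pos: "Re (h z0) > 0"
      using ln_gt_zero[OF s[of z0]] ln[of z0] R by simp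
    have "norm (z - z0) \<le> R - norm (z - z0)"
      using z by (simp add: dist_norm norm_minus_commute)
    then have "norm (z - z0) / (R - norm (z - z0)) \<le> 1"
      using z R by (simp add: dist_norm norm_minus_commute)
    from mult_left_mono[OF this, of "2 * Re (h z0)"] pos show ?thesis by simp
  qed
  finally have "\<bar>Re (h z0 - h z)\<bar> \<le> 2 * Re (h z0)"
    using abs_Re_le_cmod[of "h z0 - h z"] by (simp add: u_def)
  then show ?thesis
    using ln[of z] ln[of z0] z R by simp
qed

lemma entire_norm_le_on_ball:
  assumes hol: "g holomorphic_on UNIV" and bd: "\<And>z. norm z = R \<Longrightarrow> norm (g z) \<le> B"
    and z: "norm z \<le> R" and "0 < R"
  shows "norm (g z) \<le> B"
proof (rule maximum_modulus_frontier[where S = "cball 0 R" and f = g])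
  show "g holomorphic_on interior (cball 0 R)" "continuous_on (closure (cball 0 R)) g"
    using hol holomorphic_on_subset by (blast intro: holomorphic_on_imp_continuous_on)+
  show "norm (g w) \<le> B" if "w \<in> frontier (cball 0 R)" for w
    using that \<open>0 < R\<close> by (intro bd) (simp add: frontier_cball dist_norm)
qed (use z in auto)

section \<open>Finite factorizations\<close>

text \<open>The bound holds at every point and tends to 1 at 0, so zeros can be counted at every
  scale \<open>t > 0\<close> without a threshold radius.\<close>

locale entire_exp_growth =
  fixes f :: "complex \<Rightarrow> complex" and C \<alpha> :: real
  assumes hol: "f holomorphic_on UNIV" and f0: "f 0 = 1"
    and growth: "\<And>z. norm (f z) \<le> exp (C * norm z powr \<alpha>)"
    and C: "0 < C" and \<alpha>: "0 < \<alpha>" "\<alpha> < 1 / 2"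
begin

text \<open>Multiple zeros appear as repeated values of \<open>a\<close>. The cofactor may still
  vanish, so a part of a factorization is again one, and constants can be sought that serve all of
  them at once.\<close>

definition factorization :: "nat set \<Rightarrow> (nat \<Rightarrow> complex) \<Rightarrow> (complex \<Rightarrow> complex) \<Rightarrow> bool" where
  "factorization I a h \<longleftrightarrow> finite I \<and> h holomorphic_on UNIV \<and> (\<forall>i\<in>I. a i \<noteq> 0) \<and>
     (\<forall>z. f z = h z * (\<Prod>i\<in>I. 1 - z / a i))"

lemma factorization_subset:
  assumes "factorization I a h" "J \<subseteq> I"
  shows "factorization J a (\<lambda>z. h z * (\<Prod>i\<in>I - J. 1 - z / a i))"
proof -
  have "finite I" using assms by (simp add: factorization_def)
  then have "finite J" "finite (I - J)" using assms finite_subset by auto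
  have "(\<Prod>i\<in>I. 1 - z / a i) = (\<Prod>i\<in>I - J. 1 - z / a i) * (\<Prod>i\<in>J. 1 - z / a i)" for z
    using prod.subset_diff[OF assms(2) \<open>finite I\<close>] .
  then show ?thesis
    using assms \<open>finite J\<close> by (auto simp: factorization_def intro!: holomorphic_intros)
qed

text \<open>A Jensen-type estimate from the maximum principle: on \<open>|w| = (1 + c) * t\<close>
  each factor has modulus at least \<open>c\<close>, so \<open>|h| \<le> |f| / c ^ card I\<close>
  there. With \<open>c = 3\<close> and \<open>z = 0\<close> it counts zeros; with
  \<open>c = 1\<close> it bounds the cofactor on \<open>|z| \<le> 2 * t\<close>.\<close>

lemma factorization_norm_le:
  assumes fac: "factorization I a h" and at: "\<And>i. i \<in> I \<Longrightarrow> norm (a i) \<le> t" and t: "0 < t"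
    and c: "1 \<le> c" and z: "norm z \<le> (1 + c) * t"
  shows "norm (h z) * c ^ card I \<le> exp (C * ((1 + c) * t) powr \<alpha>)"
proof -
  have "norm (h z) \<le> exp (C * ((1 + c) * t) powr \<alpha>) / c ^ card I"
  proof (rule entire_norm_le_on_ball[where g = h and R = "(1 + c) * t"])
    show "h holomorphic_on UNIV" using fac by (simp add: factorization_def)
    fix w :: complex assume w: "norm w = (1 + c) * t"
    have "c \<le> norm (1 - w / a i)" if "i \<in> I" for i
    proof -
      have "norm (a i) > 0" using fac that by (simp add: factorization_def)
      have "(1 + c) * norm (a i) \<le> norm w"
        using at[OF that] w c by (simp add: mult_left_mono divide_right_mono)
      then have "1 + c \<le> norm (w / a i)"
        using \<open>norm (a i) > 0\<close> by (simp add: norm_divide pos_le_divide_eq)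
      then show ?thesis
        using norm_triangle_ineq2[of "w / a i" 1] by (simp add: norm_minus_commute)
    qed
    then have "(\<Prod>i\<in>I. c) \<le> (\<Prod>i\<in>I. norm (1 - w / a i))"
      using c by (intro prod_mono) auto
    then have "norm (h w) * c ^ card I \<le> norm (h w) * (\<Prod>i\<in>I. norm (1 - w / a i))"
      by (intro mult_left_mono) auto
    also have "\<dots> = norm (f w)"
      using fac by (simp add: factorization_def norm_mult flip: prod_norm)
    also have "\<dots> \<le> exp (C * ((1 + c) * t) powr \<alpha>)"
      using growth[of w] w by simp
    finally show "norm (h w) \<le> exp (C * ((1 + c) * t) powr \<alpha>) / c ^ card I"
      using c by (simp add: field_simps)
  qed (use t c z in auto)
  then show ?thesis using c by (simp add: field_simps)
qed

lemma factorization_at_0: "factorization I a h \<Longrightarrow> h 0 = 1"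
  using f0 by (auto simp: factorization_def dest: spec[of _ 0])

lemma factorization_card_le:
  assumes fac: "factorization I a h" and t: "0 < t"
  shows "card {i\<in>I. norm (a i) \<le> t} \<le> C * (4 * t) powr \<alpha>"
proof -
  let ?J = "{i\<in>I. norm (a i) \<le> t}"
  have fac': "factorization ?J a (\<lambda>z. h z * (\<Prod>i\<in>I - ?J. 1 - z / a i))"
    by (rule factorization_subset[OF fac]) auto
  \<comment> \<open>The choice \<open>c = 3\<close> is made because \<open>exp 1 \<le> 3\<close>; it
    puts the circle at radius \<open>4 * t\<close>.\<close>
  have "exp (real (card ?J)) = exp 1 ^ card ?J"
    by (simp flip: exp_of_nat_mult)
  also have "\<dots> \<le> 3 ^ card ?J"
    using exp_le by (intro power_mono) auto
  also have "\<dots> \<le> exp (C * (4 * t) powr \<alpha>)"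
    using factorization_norm_le[OF fac', of t 3 0] factorization_at_0[OF fac] t by auto
  finally show ?thesis by simp
qed

text \<open>Induction on the number of factors, removing the largest \<open>a j\<close>: all \<open>card I\<close> points are then
  counted by \<open>factorization_card_le\<close> at \<open>t = |a j|\<close>, so \<open>|a j|\<close> is at least of order
  \<open>(card I)\<^sup>1\<^sup>/\<^sup>\<alpha>\<close>, independently of the factorization.\<close>

lemma factorization_sum_le:
  assumes "\<alpha> < \<beta>"
  obtains K where "0 \<le> K"
    "\<And>I a h. factorization I a h \<Longrightarrow> (\<Sum>i\<in>I. norm (a i) powr - \<beta>) \<le> K"
proof -
  define D where "D = C * 4 powr \<alpha>"
  have D: "D > 0" using C by (simp add: D_def)
  \<comment> \<open>\<open>n \<le> D * |a j| powr \<alpha>\<close> becomes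
    \<open>|a j| powr - \<beta> \<le> b n\<close>. The series converges because
    \<open>\<beta> / \<alpha> > 1\<close>, and \<open>b 0 = 0\<close> since
    \<open>0 powr x = 0\<close>.\<close>
  define b where "b n = D powr (\<beta> / \<alpha>) * (real n powr - (\<beta> / \<alpha>))" for n :: nat
  have "\<beta> / \<alpha> > 1" using assms \<alpha> by simp
  then have sb: "summable b"
    unfolding b_def by (intro summable_mult) (simp add: summable_real_powr_iff)
  have b0: "b n \<ge> 0" for n by (simp add: b_def)
  have *: "(\<Sum>i\<in>I. norm (a i) powr - \<beta>) \<le> (\<Sum>n\<le>card I. b n)" if "factorization I a h" for I a h
    using that
  proof (induction "card I" arbitrary: I h)
    case 0
    then show ?case by (auto simp: factorization_def b_def)
  next
    case (Suc n)
    then have fin: "finite I" "I \<noteq> {}" by (auto simp: factorization_def)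
    obtain j where j: "j \<in> I" "\<And>i. i \<in> I \<Longrightarrow> norm (a i) \<le> norm (a j)"
      using fin obtains_MAX[of I "\<lambda>i. norm (a i)"] by (metis Max_ge finite_imageI image_eqI)
    have aj: "norm (a j) > 0" using Suc.prems j by (simp add: factorization_def)
    have cs: "card (I - {j}) = n" using Suc.hyps(2) j fin by simp
    have "{i\<in>I. norm (a i) \<le> norm (a j)} = I" using j by auto
    then have "real (card I) \<le> D * norm (a j) powr \<alpha>"
      using factorization_card_le[OF Suc.prems aj] aj by (simp add: D_def powr_mult mult_ac)
    then have "card I / D \<le> norm (a j) powr \<alpha>" using D by (simp add: field_simps)
    then have "(card I / D) powr (\<beta> / \<alpha>) \<le> (norm (a j) powr \<alpha>) powr (\<beta> / \<alpha>)"
      using D \<alpha> assms by (intro powr_mono2) auto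
    then have le: "(card I / D) powr (\<beta> / \<alpha>) \<le> norm (a j) powr \<beta>"
      using \<alpha> by (simp add: powr_powr)
    have "0 < (card I / D) powr (\<beta> / \<alpha>)" using D Suc.hyps(2) by (simp add: zero_less_iff_neq_zero)
    with le have "norm (a j) powr - \<beta> \<le> inverse ((card I / D) powr (\<beta> / \<alpha>))"
      unfolding powr_minus by (intro le_imp_inverse_le)
    also have "\<dots> = b (card I)"
      using D by (simp add: b_def powr_divide powr_minus divide_simps)
    finally have "norm (a j) powr - \<beta> \<le> b (card I)" .
    moreover have "(\<Sum>i\<in>I - {j}. norm (a i) powr - \<beta>) \<le> (\<Sum>n\<le>n. b n)"
      using Suc.hyps(1)[OF cs[symmetric] factorization_subset[OF Suc.prems]] cs by auto
    ultimately show ?case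
      using sum.remove[OF fin(1) j(1), of "\<lambda>i. norm (a i) powr - \<beta>"] Suc.hyps(2)[symmetric] by simp
  qed
  show ?thesis
  proof (rule that)
    show "0 \<le> suminf b" using suminf_nonneg[OF sb b0] .
    show "(\<Sum>i\<in>I. norm (a i) powr - \<beta>) \<le> suminf b" if "factorization I a h" for I a h
      using *[OF that] sum_le_suminf[OF sb, of "{..card I}"] b0 by force
  qed
qed

text \<open>\<open>ln (1 + x) \<le> 2 / \<beta> * x powr \<beta>\<close> reduces the product to the
  sum of \<open>|a i| powr - \<beta>\<close>; here \<open>\<beta> < 1\<close> serves small
  \<open>x\<close> and \<open>\<beta> > 0\<close> large \<open>x\<close>. \<open>K\<close> must not
  depend on the factorization, because a new one is taken for each \<open>R\<close>.\<close>

lemma factorization_prod_le: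
  assumes "\<alpha> < \<beta>" "\<beta> < 1"
  obtains K where "0 \<le> K"
    "\<And>I a h R. factorization I a h \<Longrightarrow> 0 < R \<Longrightarrow> (\<Prod>i\<in>I. 1 + R / norm (a i)) \<le> exp (K * R powr \<beta>)"
proof -
  obtain K where K: "0 \<le> K"
    "\<And>I a h. factorization I a h \<Longrightarrow> (\<Sum>i\<in>I. norm (a i) powr - \<beta>) \<le> K"
    using factorization_sum_le[OF assms(1)] by blast
  have \<beta>: "0 < \<beta>" using assms \<alpha> by simp
  have ln_le: "ln (1 + x) \<le> 2 / \<beta> * x powr \<beta>" if x: "x > 0" for x :: real
  proof (cases "x \<le> 1")
    case True
    have "ln (1 + x) \<le> x powr 1" using x ln_add_one_self_le_self[of x] by simp
    also have "\<dots> \<le> x powr \<beta>" using True x assms by (intro powr_mono') auto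
    also have "\<dots> \<le> 2 / \<beta> * x powr \<beta>" using \<beta> assms x by (simp add: field_simps)
    finally show ?thesis .
  next
    case False
    then have "ln (1 + x) \<le> (1 + x) powr \<beta> / \<beta>" using \<beta> by (intro ln_powr_bound) auto
    also have "(1 + x) powr \<beta> \<le> (2 * x) powr \<beta>" using False \<beta> by (intro powr_mono2) auto
    also have "\<dots> = 2 powr \<beta> * x powr \<beta>" using x by (simp add: powr_mult)
    also have "2 powr \<beta> \<le> (2::real) powr 1" using assms by (intro powr_mono) auto
    finally show ?thesis using \<beta> x by (simp add: divide_right_mono)
  qed
  show ?thesis
  proof (rule that)
    show "0 \<le> 2 / \<beta> * K" using K \<beta> by simp
    fix I a h and R :: real assume fac: "factorization I a h" and R: "0 < R"
    then have a: "i \<in> I \<Longrightarrow> norm (a i) > 0" and fin: "finite I" for i by (auto simp: factorization_def)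
    have "(\<Prod>i\<in>I. 1 + R / norm (a i)) \<le> (\<Prod>i\<in>I. exp (2 / \<beta> * R powr \<beta> * norm (a i) powr - \<beta>))"
    proof (intro prod_mono conjI)
      fix i assume i: "i \<in> I"
      have "1 + R / norm (a i) = exp (ln (1 + R / norm (a i)))"
        using a[OF i] R by (simp add: add_pos_pos)
      also have "\<dots> \<le> exp (2 / \<beta> * (R / norm (a i)) powr \<beta>)"
        using ln_le[of "R / norm (a i)"] a[OF i] R by simp
      finally show "1 + R / norm (a i) \<le> exp (2 / \<beta> * R powr \<beta> * norm (a i) powr - \<beta>)"
        using a[OF i] R by (simp add: powr_divide powr_minus divide_simps)
      show "0 \<le> 1 + R / norm (a i)" using R by simp
    qed
    also have "\<dots> = exp (2 / \<beta> * R powr \<beta> * (\<Sum>i\<in>I. norm (a i) powr - \<beta>))"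
      using fin by (simp add: exp_sum sum_distrib_left)
    also have "\<dots> \<le> exp (2 / \<beta> * R powr \<beta> * K)"
      using K(2)[OF fac] \<beta> by (simp add: mult_left_mono divide_right_mono)
    finally show "(\<Prod>i\<in>I. 1 + R / norm (a i)) \<le> exp (2 / \<beta> * K * R powr \<beta>)"
      by (simp add: mult_ac)
  qed
qed

end

section \<open>The slit disc and the minimum modulus of normalized functions\<close>

text \<open>Maximum principle for \<open>P(w\<^sup>2)\<close> with \<open>P(z) = \<Prod>(1 - z / b\<^sub>i)\<close> on the upper half of the disc of radius
  \<open>S = \<surd>R\<close>, with the barrier \<open>Re (w\<^sup>2/S\<^sup>2 - 2iw/S)\<close>: it is nonnegative on the diameter, equals
  \<open>1 + 2(y/S)(1 - y/S) \<ge> 1\<close> on the semicircle, and is at most \<open>2\<surd>(s/R)\<close> at \<open>w = i\<surd>s\<close>. The exponent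
  \<open>1/2\<close> here is the source of the bound on the order.\<close>

lemma half_disc_bound:
  fixes b :: "nat \<Rightarrow> real" and R s M :: real
  assumes I: "finite I" and b: "\<And>i. i \<in> I \<Longrightarrow> 0 < b i" and R: "0 < R" and M: "1 \<le> M"
    and le: "\<And>x. 0 \<le> x \<Longrightarrow> x \<le> R \<Longrightarrow> (\<Prod>i\<in>I. \<bar>1 - x / b i\<bar>) \<le> M"
    and s: "0 \<le> s" "s \<le> R"
  shows "(\<Prod>i\<in>I. 1 + s / b i) \<le> M * exp (2 * ln (\<Prod>i\<in>I. 1 + R / b i) * sqrt (s / R))"
proof -
  define S where "S = sqrt R"
  have S: "S > 0" "S\<^sup>2 = R" using R by (auto simp: S_def)
  define N where "N = (\<Prod>i\<in>I. 1 + R / b i)"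
  have N1: "N \<ge> 1" unfolding N_def using b R by (intro prod_ge_1) (simp add: less_imp_le)
  define B where "B = ln N"
  have B: "B \<ge> 0" "exp B = N" using N1 by (auto simp: B_def)
  define P where "P z = (\<Prod>i\<in>I. 1 - z / of_real (b i))" for z :: complex
  \<comment> \<open>Squaring opens the upper half-disc to the disc slit along \<open>[0, R]\<close>:
    the diameter covers the slit, where \<open>|P| \<le> M\<close>, and \<open>\<i> * sqrt s\<close>
    goes to \<open>-s\<close>, where the factors are \<open>1 + s / b i\<close>. The exponential
    cancels the size \<open>N = exp B\<close> on the semicircle.\<close>
  define Q where "Q w = P (w\<^sup>2) * exp (- of_real B * (w\<^sup>2 / of_real R - 2 * \<i> * w / of_real S))"
    for w
  have normQ: "norm (Q w) = norm (P (w\<^sup>2)) *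
      exp (- B * (((Re w)\<^sup>2 - (Im w)\<^sup>2) / R + 2 * Im w / S))" for w
    by (simp add: Q_def norm_mult power2_eq_square algebra_simps diff_divide_distrib)
  define T where "T = cball 0 S \<inter> {w :: complex. 0 \<le> Im w}"
  have clT: "closed T" unfolding T_def by (intro closed_Int closed_halfspace_Im_ge) auto
  have Qhol: "Q holomorphic_on UNIV"
    unfolding Q_def P_def using R S by (intro holomorphic_intros) (use b in force)+
  have "norm (Q (\<i> * of_real (sqrt s))) \<le> M"
  proof (rule maximum_modulus_frontier[where f = Q and S = T])
    show "Q holomorphic_on interior T" "continuous_on (closure T) Q"
      using Qhol holomorphic_on_subset by (blast intro: holomorphic_on_imp_continuous_on)+
    show "bounded T" unfolding T_def by (rule bounded_subset[of "cball 0 S"]) auto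
    show "\<i> * of_real (sqrt s) \<in> T" using s by (simp add: T_def norm_mult S_def)
    fix w assume w: "w \<in> frontier T"
    have "ball 0 S \<inter> {w. 0 < Im w} \<subseteq> interior T"
      by (rule interior_maximal) (auto simp: T_def intro!: open_Int open_halfspace_Im_gt)
    moreover have "w \<in> T" "w \<notin> interior T"
      using w clT by (simp_all add: frontier_def)
    ultimately have "w \<notin> ball 0 S \<inter> {w. 0 < Im w}" "w \<in> T" by blast+
    then have "norm w = S \<or> Im w = 0" and wS: "norm w \<le> S" "0 \<le> Im w"
      by (auto simp: T_def)
    from \<open>norm w = S \<or> Im w = 0\<close> show "norm (Q w) \<le> M"
    proof
      assume nw: "norm w = S"
      have "norm (P (w\<^sup>2)) \<le> (\<Prod>i\<in>I. 1 + R / b i)"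
        unfolding P_def prod_norm[symmetric]
      proof (intro prod_mono conjI)
        fix i assume "i \<in> I"
        then show "norm (1 - w\<^sup>2 / of_real (b i)) \<le> 1 + R / b i"
          using norm_triangle_ineq4[of 1 "w\<^sup>2 / of_real (b i)"] b[of i] nw S
          by (simp add: norm_divide norm_power)
      qed auto
      then have 1: "norm (P (w\<^sup>2)) \<le> exp B" by (simp add: B N_def)
      have eq: "(Re w)\<^sup>2 = R - (Im w)\<^sup>2" using nw S(2) cmod_power2[of w] by simp
      have "Im w \<le> S" using abs_Im_le_cmod[of w] nw by simp
      then have "(Im w)\<^sup>2 \<le> Im w * S" using wS by (simp add: power2_eq_square mult_left_mono)
      moreover have "((Re w)\<^sup>2 - (Im w)\<^sup>2) / R + 2 * Im w / S = 1 + 2 * (Im w * S - (Im w)\<^sup>2) / R"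
        unfolding eq S(2)[symmetric] using S(1) by (simp add: field_simps power2_eq_square)
      ultimately have "1 \<le> ((Re w)\<^sup>2 - (Im w)\<^sup>2) / R + 2 * Im w / S"
        using R by simp
      then have "exp (- B * (((Re w)\<^sup>2 - (Im w)\<^sup>2) / R + 2 * Im w / S)) \<le> exp (- B)"
        using B(1) mult_left_mono by fastforce
      with 1 have "norm (Q w) \<le> exp B * exp (- B)"
        unfolding normQ by (intro mult_mono) auto
      with M show ?thesis by (simp flip: exp_add)
    next
      assume im: "Im w = 0"
      define x where "x = (Re w)\<^sup>2"
      have w2: "w\<^sup>2 = of_real x" using im by (simp add: x_def complex_eq_iff power2_eq_square)
      have x: "0 \<le> x" "x \<le> R"
        using wS(1) im S power_mono[of "norm w" S 2] by (auto simp: x_def cmod_def)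
      have "norm (P (w\<^sup>2)) = (\<Prod>i\<in>I. \<bar>1 - x / b i\<bar>)"
        unfolding P_def w2 prod_norm[symmetric]
        by (intro prod.cong refl) (metis norm_of_real of_real_1 of_real_diff of_real_divide)
      then have "norm (P (w\<^sup>2)) \<le> M" using le[OF x] by simp
      moreover have "exp (- B * (((Re w)\<^sup>2 - (Im w)\<^sup>2) / R + 2 * Im w / S)) \<le> 1"
        using im B(1) R by simp
      ultimately show ?thesis
        unfolding normQ using M mult_mono[of "norm (P (w\<^sup>2))" M _ 1] by simp
    qed
  qed
  moreover have "norm (P ((\<i> * of_real (sqrt s))\<^sup>2)) = (\<Prod>i\<in>I. 1 + s / b i)"
  proof -
    have "P ((\<i> * of_real (sqrt s))\<^sup>2) = of_real (\<Prod>i\<in>I. 1 + s / b i)"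
      using s unfolding P_def by (simp add: power_mult_distrib flip: of_real_power)
    moreover have "0 \<le> (\<Prod>i\<in>I. 1 + s / b i)"
      using s b by (intro prod_nonneg) (simp add: add_nonneg_nonneg less_imp_le)
    ultimately show ?thesis by (simp only: norm_of_real abs_of_nonneg)
  qed
  ultimately have "(\<Prod>i\<in>I. 1 + s / b i) * exp (- (B * (- s / R + 2 * sqrt s / S))) \<le> M"
    using s by (simp add: normQ)
  moreover define E where "E = B * (- s / R + 2 * sqrt s / S)"
  ultimately have "(\<Prod>i\<in>I. 1 + s / b i) * exp (- E) \<le> M"
    by (simp only:)
  then have "(\<Prod>i\<in>I. 1 + s / b i) \<le> M * exp E"
    by (simp add: exp_minus field_simps)
  also have "\<dots> \<le> M * exp (B * (2 * sqrt s / S))"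
  proof -
    have "E \<le> B * (2 * sqrt s / S)"
      unfolding E_def using B(1) s R by (intro mult_left_mono) auto
    then show ?thesis using M by simp
  qed
  finally show ?thesis
    by (simp add: B_def N_def S_def real_sqrt_divide mult_ac)
qed

context entire_exp_growth
begin

text \<open>The number of factors is bounded by \<open>factorization_card_le\<close>, so a factorization with the most factors exists, and
  its cofactor has no zero left to split off.\<close>

lemma factorization_exists:
  assumes R: "0 < R"
  obtains I a h where "factorization I a h" "\<And>i. i \<in> I \<Longrightarrow> norm (a i) \<le> R"
    "\<And>z. norm z < R \<Longrightarrow> h z \<noteq> 0"
proof -
  define P where "P n \<longleftrightarrow> (\<exists>I a h. factorization I a h \<and> (\<forall>i\<in>I. norm (a i) \<le> R) \<and> card I = n)" for n
  have "P 0" unfolding P_def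
    by (intro exI[of _ "{}"] exI[of _ f] exI) (simp add: factorization_def hol)
  moreover have "n \<le> nat \<lceil>C * (4 * R) powr \<alpha>\<rceil>" if Pn: "P n" for n
  proof -
    obtain I a h where I: "factorization I a h" "\<forall>i\<in>I. norm (a i) \<le> R" "card I = n"
      using Pn unfolding P_def by blast
    then have "{i\<in>I. norm (a i) \<le> R} = I" by auto
    with factorization_card_le[OF I(1) R] I(3) show ?thesis by simp linarith
  qed
  ultimately obtain n where n: "P n" "\<And>m. P m \<Longrightarrow> m \<le> n"
    using ex_has_greatest_nat[of P 0 id "Suc (nat \<lceil>C * (4 * R) powr \<alpha>\<rceil>)"]
    by (auto simp: less_Suc_eq_le)
  then obtain I a h where I: "factorization I a h" "\<forall>i\<in>I. norm (a i) \<le> R" "card I = n"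
    by (auto simp: P_def)
  have "h \<zeta> \<noteq> 0" if \<zeta>: "norm \<zeta> < R" for \<zeta>
  proof
    assume h\<zeta>: "h \<zeta> = 0"
    then have \<zeta>0: "\<zeta> \<noteq> 0" using factorization_at_0[OF I(1)] by auto
    define h' where "h' z = - \<zeta> * (if z = \<zeta> then deriv h \<zeta> else (h z - h \<zeta>) / (z - \<zeta>))" for z
    have "h' holomorphic_on UNIV"
      unfolding h'_def using I(1) by (intro holomorphic_intros pole_lemma_open) (auto simp: factorization_def)
    moreover have "h z = h' z * (1 - z / \<zeta>)" for z
      using \<zeta>0 h\<zeta> by (auto simp: h'_def field_simps)
    moreover obtain j where j: "j \<notin> I"
      using I(1) ex_new_if_finite[of I] by (auto simp: factorization_def)
    moreover have "(\<Prod>i\<in>I. 1 - z / (a(j := \<zeta>)) i) = (\<Prod>i\<in>I. 1 - z / a i)" for z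
      using j by (intro prod.cong) auto
    ultimately have "factorization (insert j I) (a(j := \<zeta>)) h'"
      using I(1) \<zeta>0 unfolding factorization_def by auto
    moreover have "\<forall>i\<in>insert j I. norm ((a(j := \<zeta>)) i) \<le> R" "card (insert j I) = Suc n"
      using I j \<zeta> by (auto simp: factorization_def)
    ultimately have "P (Suc n)" unfolding P_def by blast
    with n(2) show False by fastforce
  qed
  with I that show ?thesis by blast
qed

text \<open>A finite stand-in for the Hadamard product. When all zeros up to a radius
  \<open>t\<close> far beyond \<open>R\<close> are split off, the cofactor has a logarithm on
  \<open>|z| < t\<close> whose real part is at most of order \<open>t powr \<alpha>\<close>, and
  Borel-Caratheodory shrinks this on \<open>|z| \<le> R\<close> by a factor of order
  \<open>R / t\<close>.\<close>

lemma factorization_approx: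
  assumes R: "0 < R" and e: "0 < e"
  obtains I a h where "factorization I a h"
    "\<And>z. norm z \<le> R \<Longrightarrow> exp (- e) \<le> norm (h z) \<and> norm (h z) \<le> exp e"
proof -
  \<comment> \<open>The Borel-Caratheodory bound with
    \<open>A = C * (2 * x) powr \<alpha> + 1\<close>, \<open>|z| \<le> R\<close> and
    \<open>x - |z| \<ge> x / 2\<close>; the \<open>+ 1\<close> makes the bound on the real part
    strict.\<close>
  have "((\<lambda>x. 4 * (C * (2 * x) powr \<alpha> + 1) * R / x) \<longlongrightarrow> 0) at_top"
    using \<alpha> by real_asymp
  then have "\<forall>\<^sub>F x in at_top. 4 * (C * (2 * x) powr \<alpha> + 1) * R / x < e"
    using e by (rule order_tendstoD)
  then have "\<forall>\<^sub>F x in at_top. 2 * R < x \<and> 4 * (C * (2 * x) powr \<alpha> + 1) * R / x < e"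
    by (intro eventually_conj eventually_gt_at_top)
  then obtain t where t: "2 * R < t" "4 * (C * (2 * t) powr \<alpha> + 1) * R / t < e"
    by (auto simp: eventually_at_top_linorder)
  have t0: "0 < t" using t R by simp
  obtain I a h where fac: "factorization I a h" and at: "\<And>i. i \<in> I \<Longrightarrow> norm (a i) \<le> t"
    and h0: "\<And>z. norm z < t \<Longrightarrow> h z \<noteq> 0"
    using factorization_exists[OF t0] by metis
  have hh: "h holomorphic_on ball 0 t"
    using fac by (auto simp: factorization_def intro: holomorphic_on_subset)
  obtain u where u: "u holomorphic_on ball 0 t" "\<And>z. z \<in> ball 0 t \<Longrightarrow> exp (u z) = h z"
    using holomorphic_logarithm_exists[OF convex_ball open_ball hh, of 0] h0 t0 by auto
  define A where "A = C * (2 * t) powr \<alpha> + 1"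
  have "exp (- e) \<le> norm (h z) \<and> norm (h z) \<le> exp e" if z: "norm z \<le> R" for z
  proof -
    have zt: "norm z < t" using z t R by simp
    have e0: "exp (u 0) = 1" using u(2)[of 0] t0 factorization_at_0[OF fac] by simp
    have A: "A \<ge> 1" using C by (simp add: A_def)
    have "norm (u z - u 0) \<le> 2 * A * norm z / (t - norm z)"
    proof (rule borel_caratheodory[where u = "\<lambda>z. u z - u 0"])
      show "(\<lambda>z. u z - u 0) holomorphic_on ball 0 t" by (intro holomorphic_intros u)
      fix w :: complex assume w: "norm w < t"
      have "exp (Re (u w)) = norm (h w)" using u(2)[of w] w by (simp flip: norm_exp_eq_Re)
      also have "\<dots> \<le> exp (C * (2 * t) powr \<alpha>)"
        using factorization_norm_le[OF fac at t0, of 1 w] w t0 by simp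
      finally have "Re (u w) \<le> C * (2 * t) powr \<alpha>" by simp
      moreover have "Re (u 0) = 0"
        using arg_cong[OF e0, of norm] by simp
      ultimately show "Re (u w - u 0) < A" by (simp add: A_def)
    qed (use t0 zt in auto)
    also have "\<dots> \<le> 2 * A * R / (t / 2)"
      using z t t0 A R by (intro frac_le mult_left_mono mult_nonneg_nonneg) auto
    also have "\<dots> \<le> e" using t(2) by (simp add: A_def field_simps)
    finally have "\<bar>Re (u z - u 0)\<bar> \<le> e" using abs_Re_le_cmod[of "u z - u 0"] by simp
    moreover have "norm (h z) = exp (Re (u z - u 0))"
    proof -
      have "h z = exp (u z - u 0)" using u(2)[of z] zt e0 by (simp add: exp_diff)
      then show ?thesis by simp
    qed
    ultimately show ?thesis by (simp only: exp_le_cancel_iff) linarith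
  qed
  with fac that show ?thesis by blast
qed

text \<open>If every circle with radius in \<open>[r, R]\<close> had a point where
  \<open>|f|\<close> is below some value of \<open>|f|\<close> on \<open>|w| \<le> r\<close>, the
  product with zeros rotated to the positive axis would stay below \<open>exp (2 * e) * N\<close> on
  \<open>[0, R]\<close>. Then \<open>half_disc_bound\<close> at \<open>s = 2 * r\<close> says that
  doubling the radius hardly increases \<open>N\<close>. The zero \<open>\<zeta>\<close> forbids
  this: as \<open>|\<zeta>| \<le> r\<close>, its factor alone grows by at least 3/2.\<close>

lemma min_modulus_ge_max_modulus:
  assumes \<zeta>: "f \<zeta> = 0"
  obtains m r0 where "1 < m" "1 \<le> r0"
    "\<And>r. r0 \<le> r \<Longrightarrow> \<exists>\<rho>. r \<le> \<rho> \<and> \<rho> \<le> r powr m \<and>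
       (\<forall>z w. norm z = \<rho> \<longrightarrow> norm w \<le> r \<longrightarrow> norm (f w) \<le> norm (f z))"
proof -
  define \<beta> where "\<beta> = (\<alpha> + 1 / 2) / 2"
  have \<beta>: "\<alpha> < \<beta>" "\<beta> < 1 / 2" "0 < \<beta>" using \<alpha> by (auto simp: \<beta>_def)
  \<comment> \<open>Chosen so that \<open>R powr \<beta> * sqrt (r / R) = r powr - (1 / 2)\<close>
    for \<open>R = r powr m\<close>.\<close>
  define m where "m = 1 / (1 / 2 - \<beta>)"
  have m: "m * (1 / 2 - \<beta>) = 1" "m > 2" using \<beta> by (auto simp: m_def field_simps)
  have "\<beta> < 1" using \<beta> by simp
  then obtain K where K: "0 \<le> K" "\<And>I a h R. factorization I a h \<Longrightarrow> 0 < R \<Longrightarrow>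
      (\<Prod>i\<in>I. 1 + R / norm (a i)) \<le> exp (K * R powr \<beta>)"
    using factorization_prod_le[OF \<beta>(1)] by blast
  \<comment> \<open>\<open>800 * K\<^sup>2\<close> is the square of \<open>20 * K * sqrt 2\<close>;
    beyond it the exponent coming from the slit disc is at most 1/10.\<close>
  define r0 where "r0 = Max {2, norm \<zeta>, 800 * K\<^sup>2}"
  show ?thesis
  proof (rule that[of m r0])
    show "1 < m" using m by simp
    show "1 \<le> r0" by (simp add: r0_def)
    fix r assume "r0 \<le> r"
    then have r: "2 \<le> r" "norm \<zeta> \<le> r" "800 * K\<^sup>2 \<le> r" by (auto simp: r0_def)
    define R where "R = r powr m"
    have R2: "2 * r \<le> R"
    proof -
      have "2 * r \<le> r powr 2" using r by (simp add: power2_eq_square powr_numeral)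
      also have "\<dots> \<le> R" unfolding R_def using r m by (intro powr_mono) auto
      finally show ?thesis .
    qed
    have R: "0 < R" "r \<le> R" using R2 r by auto
    show "\<exists>\<rho>. r \<le> \<rho> \<and> \<rho> \<le> r powr m \<and>
       (\<forall>z w. norm z = \<rho> \<longrightarrow> norm w \<le> r \<longrightarrow> norm (f w) \<le> norm (f z))"
    proof (rule ccontr)
      assume contra: "\<not> ?thesis"
      \<comment> \<open>The cofactor costs \<open>2 * e\<close> and the slit disc another
        \<open>e\<close>; the total \<open>exp (3 / 10)\<close> has to stay below 3/2.\<close>
      define e where "e = (1 / 10 :: real)"
      obtain I a h where fac: "factorization I a h"
        and h: "\<And>z. norm z \<le> R \<Longrightarrow> exp (- e) \<le> norm (h z) \<and> norm (h z) \<le> exp e"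
        using factorization_approx[OF R(1), of e] by (auto simp: e_def)
      define b where "b i = norm (a i)" for i
      have fin: "finite I" and b: "i \<in> I \<Longrightarrow> 0 < b i" for i
        using fac by (auto simp: factorization_def b_def)
      have f: "norm (f z) = norm (h z) * (\<Prod>i\<in>I. norm (1 - z / a i))" for z
        using fac by (simp add: factorization_def norm_mult prod_norm)
      define N where "N = (\<Prod>i\<in>I. 1 + r / b i)"
      have N1: "N \<ge> 1" unfolding N_def using b r by (intro prod_ge_1) (simp add: less_imp_le)
      have fw: "norm (f w) \<le> exp e * N" if "norm w \<le> r" for w
        unfolding f N_def
      proof (intro mult_mono prod_mono conjI prod_nonneg)
        show "norm (h w) \<le> exp e" using h that R by auto
        fix i assume i: "i \<in> I"
        have "norm (1 - w / a i) \<le> 1 + norm w / b i"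
          using norm_triangle_ineq4[of 1 "w / a i"] by (simp add: norm_divide b_def)
        also have "\<dots> \<le> 1 + r / b i" using that b[OF i] by (simp add: divide_right_mono)
        finally show "norm (1 - w / a i) \<le> 1 + r / b i" .
      qed auto
      have small: "(\<Prod>i\<in>I. \<bar>1 - x / b i\<bar>) \<le> exp (2 * e) * N" if x: "0 \<le> x" "x \<le> R" for x
      proof (cases "x \<le> r")
        case True
        have "(\<Prod>i\<in>I. \<bar>1 - x / b i\<bar>) \<le> N"
          unfolding N_def
        proof (intro prod_mono conjI)
          fix i assume i: "i \<in> I"
          have "x / b i \<le> r / b i" "0 \<le> x / b i"
            using True b[OF i] x by (auto intro: divide_right_mono)
          then show "\<bar>1 - x / b i\<bar> \<le> 1 + r / b i" by linarith
        qed auto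
        also have "\<dots> \<le> exp (2 * e) * N" using N1 by (simp add: e_def)
        finally show ?thesis .
      next
        case False
        with contra x obtain z w where zw: "norm z = x" "norm w \<le> r" "norm (f z) < norm (f w)"
          unfolding R_def[symmetric] by (meson not_le less_imp_le)
        have "exp (- e) * (\<Prod>i\<in>I. \<bar>1 - x / b i\<bar>) \<le> norm (f z)"
          unfolding f
        proof (intro mult_mono prod_mono conjI prod_nonneg)
          show "exp (- e) \<le> norm (h z)" using h zw x by auto
          show "\<bar>1 - x / b i\<bar> \<le> norm (1 - z / a i)" for i
            using norm_triangle_ineq3[of 1 "z / a i"] zw(1) by (simp add: norm_divide b_def)
        qed auto
        also have "\<dots> \<le> exp e * N" using zw(3) fw[OF zw(2)] by simp
        finally have "(\<Prod>i\<in>I. \<bar>1 - x / b i\<bar>) \<le> exp e * (exp e * N)"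
          by (simp add: exp_minus field_simps)
        then show ?thesis by (simp flip: exp_add mult.assoc)
      qed
      obtain j where j: "j \<in> I" "a j = \<zeta>"
      proof -
        have "h \<zeta> \<noteq> 0" using h[of \<zeta>] r R by (metis exp_gt_zero norm_zero not_le order_trans)
        with \<zeta> fac have "\<exists>i\<in>I. 1 - \<zeta> / a i = 0" by (auto simp: factorization_def)
        then show ?thesis using that fac by (auto simp: factorization_def)
      qed
      have "3 / 2 * N \<le> (\<Prod>i\<in>I. 1 + 2 * r / b i)"
      proof -
        have "(\<Prod>i\<in>I - {j}. 1 + r / b i) \<le> (\<Prod>i\<in>I - {j}. 1 + 2 * r / b i)"
          using b r by (intro prod_mono conjI) (auto intro!: divide_right_mono simp: less_imp_le)
        moreover have "1 \<le> r / b j" using r(2) j b[OF j(1)] by (simp add: b_def)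
        then have "3 / 2 * (1 + r / b j) \<le> 1 + 2 * r / b j" by simp
        moreover have "0 \<le> (\<Prod>i\<in>I - {j}. 1 + r / b i)"
          using b r by (intro prod_nonneg) (auto simp: less_imp_le)
        ultimately have "3 / 2 * (1 + r / b j) * (\<Prod>i\<in>I - {j}. 1 + r / b i)
            \<le> (1 + 2 * r / b j) * (\<Prod>i\<in>I - {j}. 1 + 2 * r / b i)"
          using b[OF j(1)] r by (intro mult_mono) auto
        then show ?thesis
          unfolding N_def prod.remove[OF fin j(1)] by (simp only: mult.assoc)
      qed
      also have "\<dots> \<le> exp (2 * e) * N * exp (2 * ln (\<Prod>i\<in>I. 1 + R / b i) * sqrt (2 * r / R))"
      proof (rule half_disc_bound[OF fin b R(1) _ small])
        show "1 \<le> exp (2 * e) * N" using N1 mult_mono[of 1 "exp (2 * e)" 1 N] by (simp add: e_def)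
      qed (use r R2 in auto)
      also have "\<dots> \<le> exp (2 * e) * N * exp e"
      proof -
        have "0 < (\<Prod>i\<in>I. 1 + R / b i)" using b R by (intro prod_pos) (simp add: add_pos_pos)
        then have "ln (\<Prod>i\<in>I. 1 + R / b i) \<le> K * R powr \<beta>"
          using K(2)[OF fac R(1)] unfolding b_def by (metis ln_exp ln_le_cancel_iff exp_gt_zero)
        then have le1: "2 * ln (\<Prod>i\<in>I. 1 + R / b i) * sqrt (2 * r / R) \<le> 2 * (K * R powr \<beta>) * sqrt (2 * r / R)"
          using r R by (intro mult_right_mono) auto
        have "R powr \<beta> * sqrt (2 * r / R) = sqrt 2 * (R powr \<beta> * (r / R) powr (1 / 2))"
          using r R by (simp add: real_sqrt_mult real_sqrt_divide powr_half_sqrt)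
        also have "R powr \<beta> * (r / R) powr (1 / 2) = r powr (m * \<beta> + 1 / 2 - m * (1 / 2))"
          using r by (simp add: R_def powr_divide powr_powr powr_diff powr_add powr_half_sqrt)
        also have "m * \<beta> + 1 / 2 - m * (1 / 2) = - (1 / 2)"
          using m(1) by (simp add: algebra_simps)
        finally have eq: "R powr \<beta> * sqrt (2 * r / R) = sqrt 2 * r powr - (1 / 2)" .
        have "2 * (K * R powr \<beta>) * sqrt (2 * r / R) = 2 * K * (R powr \<beta> * sqrt (2 * r / R))"
          by (simp only: mult.assoc)
        with le1 have le: "2 * ln (\<Prod>i\<in>I. 1 + R / b i) * sqrt (2 * r / R)
            \<le> 2 * K * sqrt 2 * r powr - (1 / 2)" unfolding eq by (simp only: mult.assoc)
        have "(20 * K * sqrt 2)\<^sup>2 \<le> r" using r(3) by (simp add: power_mult_distrib)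
        then have "20 * K * sqrt 2 \<le> sqrt r" using real_le_rsqrt by blast
        then have "2 * K * sqrt 2 * r powr - (1 / 2) \<le> e"
          using r by (simp add: powr_minus powr_half_sqrt e_def field_simps)
        with le N1 show ?thesis by simp
      qed
      also have "\<dots> = exp (3 / 10) * N"
        by (simp add: e_def mult.commute[of _ N] mult.assoc flip: exp_add)
      finally have "3 / 2 \<le> exp (3 / 10 :: real)"
        using N1 by simp
      moreover have "1 + - (3 / 10) \<le> exp (- (3 / 10) :: real)" by (rule exp_ge_add_one_self)
      ultimately show False by (simp add: exp_minus field_simps)
    qed
  qed
qed

end

section \<open>The minimum modulus of functions of order less than 1/2\<close>

text \<open>Without zeros every cofactor is \<open>f\<close> itself, so
  \<open>factorization_approx\<close> bounds \<open>f\<close> on the whole plane and Liouville's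
  theorem applies.\<close>

lemma (in entire_exp_growth) zero_exists:
  assumes "\<not> f constant_on UNIV"
  obtains \<zeta> where "f \<zeta> = 0"
proof -
  have "\<exists>\<zeta>. f \<zeta> = 0"
  proof (rule ccontr)
    assume nz: "\<not> ?thesis"
    have "norm (f z) \<le> exp 1" for z
    proof -
      obtain I a h where fac: "factorization I a h"
        and h: "\<And>w. norm w \<le> norm z + 1 \<Longrightarrow> exp (- 1) \<le> norm (h w) \<and> norm (h w) \<le> exp 1"
        using factorization_approx[of "norm z + 1" 1] by (auto simp: add_nonneg_pos)
      have "I = {}"
      proof (rule ccontr)
        assume "I \<noteq> {}"
        then obtain i where "i \<in> I" by auto
        then have "f (a i) = 0" using fac by (auto simp: factorization_def)
        with nz show False by blast
      qed
      with fac h[of z] show ?thesis by (simp add: factorization_def)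
    qed
    then have "bounded (range f)" by (auto simp: bounded_iff)
    with Liouville_theorem[OF hol] assms show False by blast
  qed
  with that show ?thesis by blast
qed

lemma entire_bounded_on_cball:
  fixes f :: "complex \<Rightarrow> complex"
  assumes "f holomorphic_on UNIV"
  obtains B where "0 \<le> B" "\<And>z. norm z \<le> r \<Longrightarrow> norm (f z) \<le> B"
proof -
  have "continuous_on (cball 0 r) f"
    using holomorphic_on_imp_continuous_on[OF assms] by (rule continuous_on_subset) simp
  then have "bounded (f ` cball 0 r)"
    by (intro compact_imp_bounded compact_continuous_image) auto
  then obtain B where "0 < B" "\<And>x. x \<in> f ` cball 0 r \<Longrightarrow> norm x \<le> B"
    unfolding bounded_pos by blast
  with that[of B] show ?thesis by simp
qed

lemma entire_order_of_zero_factor: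
  fixes f :: "complex \<Rightarrow> complex"
  assumes hol: "f holomorphic_on UNIV" and \<xi>: "f \<xi> \<noteq> 0"
  obtains p g where "g holomorphic_on UNIV" "g 0 \<noteq> 0" "\<And>z. f z = z ^ p * g z"
proof -
  define P where "P p \<longleftrightarrow> (\<exists>g. g holomorphic_on UNIV \<and> (\<forall>z. f z = z ^ p * g z))" for p
  \<comment> \<open>The maximum principle on \<open>|z| \<le> r\<close> limits the power of
    \<open>z\<close> that can be split off: as \<open>r > 2 * |\<xi>|\<close>, it yields
    \<open>2 ^ p \<le> B / |f \<xi>|\<close>. The \<open>+ 1\<close> keeps \<open>r\<close> positive
    when \<open>\<xi> = 0\<close>.\<close>
  define r where "r = 2 * norm \<xi> + 1"
  have r: "r > 0" by (simp add: r_def add_nonneg_pos)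
  have "P 0" using hol by (auto simp: P_def)
  obtain B where B: "0 \<le> B" "\<And>z. norm z \<le> r \<Longrightarrow> norm (f z) \<le> B"
    using entire_bounded_on_cball[OF hol] by metis
  obtain b where b: "\<forall>p. P p \<longrightarrow> p < b"
  proof -
    obtain b where b: "B / norm (f \<xi>) < 2 ^ b" using real_arch_pow[of 2] by auto
    have "p < b" if Pp: "P p" for p
    proof (rule ccontr)
      assume "\<not> p < b"
      obtain g where g: "g holomorphic_on UNIV" "\<And>z. f z = z ^ p * g z"
        using Pp unfolding P_def by blast
      have "norm (g \<xi>) \<le> B / r ^ p"
      proof (rule entire_norm_le_on_ball[where g = g and R = r])
        fix z :: complex assume z: "norm z = r"
        then show "norm (g z) \<le> B / r ^ p"
          using B(2)[of z] r by (simp add: g(2) norm_mult norm_power field_simps)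
      qed (use g r in \<open>auto simp: r_def\<close>)
      then have "(2 * norm \<xi>) ^ p * norm (g \<xi>) \<le> (2 * norm \<xi>) ^ p * (B / r ^ p)"
        by (rule mult_left_mono) simp
      then have "norm (f \<xi>) * 2 ^ p \<le> (2 * norm \<xi>) ^ p * (B / r ^ p)"
        by (simp add: g(2) norm_mult norm_power power_mult_distrib mult_ac)
      also have "\<dots> \<le> r ^ p * (B / r ^ p)"
        using B(1) r
        by (intro mult_right_mono power_mono) (auto simp: r_def)
      finally have "2 ^ p \<le> B / norm (f \<xi>)" using \<xi> r by (simp add: field_simps)
      moreover have "(2::real) ^ b \<le> 2 ^ p" using \<open>\<not> p < b\<close> by (intro power_increasing) auto
      ultimately show False using b by simp
    qed
    with that show ?thesis by blast
  qed
  then obtain p where p: "P p" "\<And>q. P q \<Longrightarrow> q \<le> p"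
    using ex_has_greatest_nat[of P 0 id b] \<open>P 0\<close> by auto
  then obtain g where g: "g holomorphic_on UNIV" "\<And>z. f z = z ^ p * g z"
    by (auto simp: P_def)
  have "g 0 \<noteq> 0"
  proof
    assume g0: "g 0 = 0"
    define g' where "g' z = (if z = 0 then deriv g 0 else (g z - g 0) / (z - 0))" for z
    have "g' holomorphic_on UNIV" unfolding g'_def by (intro pole_lemma_open g open_UNIV)
    moreover have "f z = z ^ Suc p * g' z" for z using g0 by (simp add: g'_def g(2))
    ultimately have "P (Suc p)" unfolding P_def by blast
    with p(2) show False by fastforce
  qed
  with g that show ?thesis by blast
qed

lemma max_modulus_props:
  assumes hol: "f holomorphic_on UNIV" and r: "0 < r"
  shows norm_le_max_modulus: "norm z \<le> r \<Longrightarrow> norm (f z) \<le> max_modulus f r"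
    and max_modulus_attained: "\<exists>z. norm z = r \<and> norm (f z) = max_modulus f r"
proof -
  have cont: "continuous_on (sphere 0 r) (\<lambda>z. norm (f z))"
    using holomorphic_on_imp_continuous_on[OF hol] by (intro continuous_on_norm) (rule continuous_on_subset, auto)
  have ne: "sphere (0::complex) r \<noteq> {}" using r by auto
  obtain w where w: "w \<in> sphere 0 r" "\<And>z. z \<in> sphere 0 r \<Longrightarrow> norm (f z) \<le> norm (f w)"
    using continuous_attains_sup[OF compact_sphere ne cont] by blast
  have eq: "max_modulus f r = norm (f w)"
    unfolding max_modulus_def using w by (intro cSup_eq_maximum) auto
  show "\<exists>z. norm z = r \<and> norm (f z) = max_modulus f r" using w eq by auto
  show "norm z \<le> r \<Longrightarrow> norm (f z) \<le> max_modulus f r"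
    by (rule entire_norm_le_on_ball[OF hol _ _ r]) (use w eq in auto)
qed

lemma max_modulus_mono:
  assumes "f holomorphic_on UNIV" "0 < r" "r \<le> s"
  shows "max_modulus f r \<le> max_modulus f s"
  using max_modulus_attained[OF assms(1,2)] norm_le_max_modulus[OF assms(1), of s] assms
  by (metis order_less_le_trans)

lemma growth_order_less_half:
  assumes hol: "f holomorphic_on UNIV" and order: "growth_order f < ereal (1 / 2)"
  obtains \<alpha> r where "0 < \<alpha>" "\<alpha> < 1 / 2" "1 \<le> r" "\<And>z. r \<le> norm z \<Longrightarrow> norm (f z) \<le> exp (norm z powr \<alpha>)"
proof -
  obtain \<alpha>' where \<alpha>': "growth_order f < ereal \<alpha>'" "\<alpha>' < 1 / 2"
    using ereal_dense2[OF order] by auto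
  \<comment> \<open>\<open>\<alpha>'\<close> may be 0 or negative, but the locale asks for a
    positive exponent.\<close>
  define \<alpha> where "\<alpha> = max \<alpha>' (1 / 4)"
  have \<alpha>: "0 < \<alpha>" "\<alpha> < 1 / 2" using \<alpha>' by (auto simp: \<alpha>_def)
  have "growth_order f < ereal \<alpha>" using \<alpha>'(1) by (rule less_le_trans) (simp add: \<alpha>_def)
  then have "\<forall>\<^sub>F r in at_top. ereal (ln (ln (max_modulus f r)) / ln r) < ereal \<alpha>"
    unfolding growth_order_def by (rule Limsup_lessD)
  then have "\<forall>\<^sub>F r in at_top. ln (ln (max_modulus f r)) / ln r < \<alpha> \<and> 1 < r"
    using eventually_gt_at_top[of 1] by eventually_elim simp
  then obtain r0 where r0: "\<And>r. r \<ge> r0 \<Longrightarrow> ln (ln (max_modulus f r)) / ln r < \<alpha> \<and> 1 < r"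
    unfolding eventually_at_top_linorder by blast
  show ?thesis
  proof (rule that[OF \<alpha>, of "max 1 r0"])
    fix z :: complex assume z: "max 1 r0 \<le> norm z"
    define r M where "r = norm z" and "M = max_modulus f r"
    have r: "ln (ln M) / ln r < \<alpha>" "1 < r" using r0[of r] z by (auto simp: r_def M_def)
    have "M \<le> exp (r powr \<alpha>)"
    proof (cases "1 < M")
      case True
      then have "0 < ln M" by simp
      moreover from r have "ln (ln M) < \<alpha> * ln r" by (simp add: pos_divide_less_eq)
      then have "exp (ln (ln M)) < exp (\<alpha> * ln r)" by (simp only: exp_less_cancel_iff)
      ultimately have "ln M < r powr \<alpha>" using r by (simp add: powr_def)
      then have "exp (ln M) \<le> exp (r powr \<alpha>)" by simp
      with True show ?thesis by simp
    next
      case False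
      have "1 \<le> exp (r powr \<alpha>)" by simp
      with False show ?thesis by linarith
    qed
    moreover have "norm (f z) \<le> M"
      unfolding M_def using r by (intro norm_le_max_modulus hol) (auto simp: r_def)
    ultimately show "norm (f z) \<le> exp (norm z powr \<alpha>)" by (simp add: r_def)
  qed simp
qed

text \<open>Since the locale's bound tends to 1 at 0, boundedness is not enough there:
  \<open>f z = 1 + z * q z\<close> gives \<open>exp (|z| * L)\<close>, and
  \<open>|z| \<le> r * |z| powr \<alpha>\<close> on the disc. Outside it,
  \<open>|z| powr \<alpha> \<ge> 1\<close> absorbs the factor \<open>C\<close>.\<close>

lemma entire_exp_growth_extend:
  assumes hol: "f holomorphic_on UNIV" and f0: "f 0 = 1"
    and growth: "\<And>z. r \<le> norm z \<Longrightarrow> norm (f z) \<le> C * exp (norm z powr \<alpha>)"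
    and \<alpha>: "0 < \<alpha>" "\<alpha> < 1 / 2" and r: "1 \<le> r" and C: "0 < C"
  obtains K where "entire_exp_growth f K \<alpha>"
proof -
  define q where "q z = (if z = 0 then deriv f 0 else (f z - f 0) / (z - 0))" for z
  have "q holomorphic_on UNIV" unfolding q_def by (intro pole_lemma_open hol open_UNIV)
  then obtain L where L: "0 \<le> L" "\<And>z. norm z \<le> r \<Longrightarrow> norm (q z) \<le> L"
    using entire_bounded_on_cball by metis
  define K where "K = max (L * r) (1 + \<bar>ln C\<bar>) + 1"
  have "norm (f z) \<le> exp (K * norm z powr \<alpha>)" for z
  proof (cases "norm z \<le> r")
    case True
    have "f z = 1 + z * q z" by (simp add: q_def f0)
    then have "norm (f z) \<le> 1 + norm z * norm (q z)"
      by (metis norm_mult norm_one norm_triangle_ineq)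
    also have "\<dots> \<le> 1 + norm z * L" using L(2)[OF True] by (simp add: mult_left_mono)
    also have "\<dots> \<le> exp (norm z * L)" by (rule exp_ge_add_one_self)
    also have "norm z * L \<le> r * norm z powr \<alpha> * L"
    proof (rule mult_right_mono[OF _ L(1)])
      show "norm z \<le> r * norm z powr \<alpha>"
      proof (cases "norm z \<le> 1")
        case True
        have "norm z = norm z powr 1" by simp
        also have "\<dots> \<le> norm z powr \<alpha>" using True \<alpha> by (intro powr_mono') auto
        also have "\<dots> \<le> r * norm z powr \<alpha>" using r mult_right_mono[of 1 r "norm z powr \<alpha>"] by simp
        finally show ?thesis .
      next
        case False
        then have "1 \<le> norm z powr \<alpha>" using \<alpha> by (simp add: ge_one_powr_ge_zero)
        then have "r * 1 \<le> r * norm z powr \<alpha>" using r by (intro mult_left_mono) auto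
        with \<open>norm z \<le> r\<close> show ?thesis by simp
      qed
    qed
    also have "r * norm z powr \<alpha> * L \<le> K * norm z powr \<alpha>"
      using mult_right_mono[of "L * r" K "norm z powr \<alpha>"] by (simp add: K_def mult_ac)
    finally show ?thesis by simp
  next
    case False
    have "norm (f z) \<le> exp (ln C + norm z powr \<alpha>)"
      using growth[of z] False C by (simp add: exp_add)
    also have "1 \<le> norm z powr \<alpha>" using False r \<alpha> by (simp add: ge_one_powr_ge_zero)
    then have "\<bar>ln C\<bar> * 1 \<le> \<bar>ln C\<bar> * norm z powr \<alpha>" by (intro mult_left_mono) auto
    then have "ln C + norm z powr \<alpha> \<le> (1 + \<bar>ln C\<bar>) * norm z powr \<alpha>"
      by (simp add: algebra_simps)
    also have "\<dots> \<le> K * norm z powr \<alpha>" by (intro mult_right_mono) (auto simp: K_def)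
    finally show ?thesis by simp
  qed
  moreover have "K > 0" by (simp add: K_def)
  ultimately show ?thesis
    using that[of K] hol f0 \<alpha> by (simp add: entire_exp_growth_def)
qed

lemma transcendental_nonpoly:
  assumes "transcendental_entire f"
  shows "f \<noteq> (\<lambda>z. poly p z)"
  using assms by (auto simp: transcendental_entire_def)

text \<open>The zero at the origin and a constant are divided out to reach the normalization
  \<open>F 0 = 1\<close>; multiplying \<open>z ^ p\<close> back only helps, as
  \<open>\<rho> \<ge> r\<close>. Transcendence makes \<open>F\<close> nonconstant and so provides
  the zero needed above.\<close>

theorem small_order_min_modulus:
  assumes f: "transcendental_entire f" and order: "growth_order f < ereal (1 / 2)"
  obtains m r0 where "1 < m" "1 \<le> r0"
    "\<And>r. r0 \<le> r \<Longrightarrow> \<exists>\<rho>. r \<le> \<rho> \<and> \<rho> \<le> r powr m \<and> (\<forall>z. norm z = \<rho> \<longrightarrow> max_modulus f r \<le> norm (f z))"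
proof -
  have f_hol: "f holomorphic_on UNIV" using f by (simp add: transcendental_entire_def)
  obtain \<xi> where "f \<xi> \<noteq> 0"
    using transcendental_nonpoly[OF f, of 0] by auto
  then obtain p g where g: "g holomorphic_on UNIV" "g 0 \<noteq> 0" "\<And>z. f z = z ^ p * g z"
    using entire_order_of_zero_factor[OF f_hol] by blast
  define F where "F z = g z / g 0" for z
  have Fhol: "F holomorphic_on UNIV" unfolding F_def using g by (intro holomorphic_intros) auto
  have fF: "f z = g 0 * z ^ p * F z" for z using g by (simp add: F_def)
  obtain \<alpha> r1 where \<alpha>: "0 < \<alpha>" "\<alpha> < 1 / 2" "1 \<le> r1"
    and r1: "\<And>z. r1 \<le> norm z \<Longrightarrow> norm (f z) \<le> exp (norm z powr \<alpha>)"
    using growth_order_less_half[OF f_hol order] by metis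
  have "norm (F z) \<le> 1 / norm (g 0) * exp (norm z powr \<alpha>)" if "r1 \<le> norm z" for z
  proof -
    have "1 \<le> norm z ^ p" using that \<alpha> by (intro one_le_power) auto
    then have "norm (g 0) * norm (F z) \<le> norm (g 0) * norm (F z) * norm z ^ p"
      using mult_left_mono[of 1 "norm z ^ p" "norm (g 0) * norm (F z)"] by simp
    also have "\<dots> = norm (f z)" by (simp add: fF norm_mult norm_power)
    finally show ?thesis using r1[OF that] g(2) by (simp add: field_simps)
  qed
  moreover have "F 0 = 1" using g by (simp add: F_def)
  ultimately obtain K where "entire_exp_growth F K \<alpha>"
    using entire_exp_growth_extend[OF Fhol _ _ \<alpha>, of "1 / norm (g 0)"] g(2) by auto
  then interpret entire_exp_growth F K \<alpha> .
  have "\<not> F constant_on UNIV"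
  proof
    assume "F constant_on UNIV"
    then obtain c where "\<And>z. F z = c" by (auto simp: constant_on_def)
    then have "f = (\<lambda>z. poly (monom (g 0 * c) p) z)" by (auto simp: fF poly_monom)
    with transcendental_nonpoly[OF f] show False by blast
  qed
  then obtain \<zeta> where "F \<zeta> = 0" using zero_exists by blast
  then obtain m r0 where m: "1 < m" "1 \<le> r0"
    and r0: "\<And>r. r0 \<le> r \<Longrightarrow> \<exists>\<rho>. r \<le> \<rho> \<and> \<rho> \<le> r powr m \<and>
       (\<forall>z w. norm z = \<rho> \<longrightarrow> norm w \<le> r \<longrightarrow> norm (F w) \<le> norm (F z))"
    using min_modulus_ge_max_modulus by metis
  show ?thesis
  proof (rule that[OF m])
    fix r assume r: "r0 \<le> r"
    obtain \<rho> where \<rho>: "r \<le> \<rho>" "\<rho> \<le> r powr m"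
      "\<And>z w. norm z = \<rho> \<Longrightarrow> norm w \<le> r \<Longrightarrow> norm (F w) \<le> norm (F z)"
      using r0[OF r] by blast
    obtain w where w: "norm w = r" "norm (f w) = max_modulus f r"
      using max_modulus_attained[OF f_hol, of r] r m by auto
    have "max_modulus f r \<le> norm (f z)" if "norm z = \<rho>" for z
      unfolding w(2)[symmetric] fF norm_mult norm_power
      using that w(1) \<rho> by (intro mult_mono power_mono) auto
    with \<rho> show "\<exists>\<rho>. r \<le> \<rho> \<and> \<rho> \<le> r powr m \<and> (\<forall>z. norm z = \<rho> \<longrightarrow> max_modulus f r \<le> norm (f z))"
      by blast
  qed
qed

section \<open>Growth of the maximum modulus\<close>

text \<open>Only upward jumps of \<open>G\<close> are possible, so monotonicity of \<open>G\<close> replaces continuity of \<open>G - H\<close>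
  (which for \<open>G\<close> the logarithm of the convex function \<open>log M(e\<^sup>t)\<close> would need Hadamard's theorem).\<close>

lemma right_derivative_nonneg_imp_le:
  fixes G H :: "real \<Rightarrow> real"
  assumes xy: "x \<le> y" and G: "mono_on {x..y} G" and H: "continuous_on {x..y} H"
    and D: "\<And>t. x \<le> t \<Longrightarrow> t < y \<Longrightarrow>
      \<exists>D\<ge>0. ((\<lambda>t. G t - H t) has_real_derivative D) (at_right t)"
  shows "G x - H x \<le> G y - H y"
proof -
  define F where "F t = G t - H t" for t
  \<comment> \<open>The slack \<open>e\<close> turns \<open>D \<ge> 0\<close> into the strict
    \<open>- e < (F u - F t) / (u - t)\<close>, which pushes the supremum of \<open>S\<close>
    further to the right.\<close>
  have main: "F x - e * (y - x) \<le> F y" if e: "e > 0" for e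
  proof -
    define S where "S = {s \<in> {x..y}. F x - e * (s - x) \<le> F s}"
    have xS: "x \<in> S" using xy by (simp add: S_def)
    have bdd: "bdd_above S" by (rule bdd_aboveI[of _ y]) (simp add: S_def)
    define t where "t = Sup S"
    have "x \<le> t" unfolding t_def by (rule cSup_upper[OF xS bdd])
    moreover have "t \<le> y" unfolding t_def using xS by (intro cSup_least) (auto simp: S_def)
    ultimately have t: "x \<le> t" "t \<le> y" .
    have "F x - e * (t - x) \<le> F t"
    proof (rule field_le_epsilon)
      fix d :: real assume d: "d > 0"
      obtain \<delta> where \<delta>: "\<delta> > 0" "\<And>s. s \<in> {x..y} \<Longrightarrow> dist s t < \<delta> \<Longrightarrow> dist (H s) (H t) < d"
        using H t d unfolding continuous_on_iff by (metis atLeastAtMost_iff)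
      obtain s where s: "s \<in> S" "t - \<delta> < s"
        using less_cSupD[of S "t - \<delta>"] xS \<delta>(1) by (auto simp: t_def)
      have st: "s \<le> t" using cSup_upper[OF s(1) bdd] by (simp add: t_def)
      have sxy: "s \<in> {x..y}" "F x - e * (s - x) \<le> F s" using s by (auto simp: S_def)
      have "dist (H s) (H t) < d" using \<delta>(2)[OF sxy(1)] st s(2) by (simp add: dist_real_def)
      moreover have "G s \<le> G t" using mono_onD[OF G sxy(1) _ st] t by simp
      moreover have "e * (s - x) \<le> e * (t - x)" using st e by simp
      ultimately show "F x - e * (t - x) \<le> F t + d"
        using sxy(2) unfolding F_def dist_real_def by linarith
    qed
    have "t = y"
    proof (rule ccontr)
      assume "t \<noteq> y"
      with t have ty: "t < y" by simp
      obtain D where D': "D \<ge> 0" "(F has_real_derivative D) (at_right t)"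
        using D[OF t(1) ty] unfolding F_def by blast
      then have "((\<lambda>u. (F u - F t) / (u - t)) \<longlongrightarrow> D) (at_right t)"
        by (simp add: has_field_derivative_iff)
      then have "\<forall>\<^sub>F u in at_right t. - e < (F u - F t) / (u - t)"
        using D'(1) e by (intro order_tendstoD) auto
      moreover have "\<forall>\<^sub>F u in at_right t. u \<in> {t<..<y}"
        using eventually_at_right_real[OF ty] .
      ultimately have "\<forall>\<^sub>F u in at_right t. - e < (F u - F t) / (u - t) \<and> u \<in> {t<..<y}"
        by (rule eventually_conj)
      then have "\<exists>u. - e < (F u - F t) / (u - t) \<and> u \<in> {t<..<y}"
        by (intro eventually_happens'[OF trivial_limit_at_right_real])
      then obtain u where u: "- e < (F u - F t) / (u - t)" "u \<in> {t<..<y}" by blast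
      then have "- e * (u - t) < F u - F t" by (simp add: pos_less_divide_eq)
      with \<open>F x - e * (t - x) \<le> F t\<close> have "F x - e * (u - x) \<le> F u"
        by (simp add: algebra_simps)
      with u(2) t have "u \<in> S" by (simp add: S_def)
      from cSup_upper[OF this bdd] u(2) show False by (simp add: t_def)
    qed
    with \<open>F x - e * (t - x) \<le> F t\<close> show ?thesis by simp
  qed
  have "F x \<le> F y"
  proof (rule field_le_epsilon)
    fix d :: real assume "d > 0"
    define e where "e = d / (y - x + 1)"
    have "e > 0" "e * (y - x) \<le> d" using \<open>d > 0\<close> xy by (auto simp: e_def field_simps)
    with main[of e] show "F x \<le> F y + d" by simp
  qed
  then show ?thesis by (simp add: F_def)
qed

text \<open>Some Taylor coefficient of index at least \<open>n\<close> is nonzero, and Cauchy's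
  inequality applies to it.\<close>

lemma transcendental_max_modulus_ge:
  assumes f: "transcendental_entire f"
  obtains c where "0 < c" "\<And>r. 1 \<le> r \<Longrightarrow> c * r ^ n \<le> max_modulus f r"
proof -
  have hol: "f holomorphic_on UNIV" using f by (simp add: transcendental_entire_def)
  define a where "a k = (deriv ^^ k) f 0 / fact k" for k
  obtain k where k: "n \<le> k" "a k \<noteq> 0"
  proof (rule ccontr)
    assume "\<not> thesis"
    with that have z: "a k = 0" if "n \<le> k" for k using \<open>n \<le> k\<close> by blast
    have "f w = poly (\<Sum>k<n. monom (a k) k) w" for w
    proof -
      have "(\<lambda>k. a k * (w - 0) ^ k) sums f w"
        unfolding a_def using hol
        by (intro holomorphic_power_series[where r = "norm w + 1"]) (auto intro: holomorphic_on_subset)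
      moreover have "(\<lambda>k. a k * (w - 0) ^ k) sums (\<Sum>k<n. a k * (w - 0) ^ k)"
        using z by (intro sums_finite) auto
      ultimately show ?thesis by (simp add: sums_unique2 poly_sum poly_monom)
    qed
    then show False using f by (auto simp: transcendental_entire_def)
  qed
  show ?thesis
  proof (rule that[of "norm (a k)"])
    fix r :: real assume r: "1 \<le> r"
    have "norm ((deriv ^^ k) f 0) \<le> fact k * max_modulus f r / r ^ k"
      using r hol by (intro Cauchy_inequality norm_le_max_modulus)
        (auto intro: holomorphic_on_subset holomorphic_on_imp_continuous_on)
    then have "norm (a k) * r ^ k \<le> max_modulus f r"
      using r by (simp add: a_def norm_divide field_simps)
    moreover have "r ^ n \<le> r ^ k" using r k by (intro power_increasing)
    then have "norm (a k) * r ^ n \<le> norm (a k) * r ^ k" by (intro mult_left_mono) auto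
    ultimately show "norm (a k) * r ^ n \<le> max_modulus f r" by linarith
  qed (use k in simp)
qed

lemma max_modulus_annulus:
  assumes hol: "f holomorphic_on UNIV" and r: "1 < r" "r \<le> T"
  shows "max_modulus f r / r ^ k \<le> max (max_modulus f 1) (max_modulus f T / T ^ k)"
proof -
  define B where "B = max (max_modulus f 1) (max_modulus f T / T ^ k)"
  define S where "S = {z :: complex. 1 \<le> norm z \<and> norm z \<le> T}"
  have clS: "closed S" unfolding S_def by (intro closed_Collect_conj closed_Collect_le continuous_intros)
  have Shol: "(\<lambda>z. f z / z ^ k) holomorphic_on S"
    by (intro holomorphic_intros holomorphic_on_subset[OF hol]) (auto simp: S_def)
  obtain w where w: "norm w = r" "norm (f w) = max_modulus f r"
    using max_modulus_attained[OF hol, of r] r by auto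
  have "norm (f w / w ^ k) \<le> B"
  proof (rule maximum_modulus_frontier[where S = S and f = "\<lambda>z. f z / z ^ k"])
    show "(\<lambda>z. f z / z ^ k) holomorphic_on interior S"
      using Shol interior_subset by (rule holomorphic_on_subset)
    show "continuous_on (closure S) (\<lambda>z. f z / z ^ k)"
      using Shol clS by (simp add: holomorphic_on_imp_continuous_on)
    show "bounded S" unfolding S_def bounded_iff by blast
    show "w \<in> S" using w r by (simp add: S_def)
    fix z assume z: "z \<in> frontier S"
    have "{z :: complex. 1 < norm z \<and> norm z < T} \<subseteq> interior S"
      by (rule interior_maximal)
        (auto simp: S_def intro!: open_Collect_conj open_Collect_less continuous_intros)
    moreover have "z \<in> S" "z \<notin> interior S" using z clS by (simp_all add: frontier_def)
    ultimately have "norm z = 1 \<or> norm z = T" by (force simp: S_def)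
    then show "norm (f z / z ^ k) \<le> B"
    proof
      assume "norm z = 1"
      then show ?thesis using norm_le_max_modulus[OF hol, of 1 z]
        by (simp add: B_def norm_divide norm_power)
    next
      assume nz: "norm z = T"
      then have "norm (f z) / norm z ^ k \<le> max_modulus f T / T ^ k"
        using norm_le_max_modulus[OF hol, of T z] r by (simp add: divide_right_mono)
      with nz show ?thesis by (simp add: B_def norm_divide norm_power)
    qed
  qed
  with w show ?thesis by (simp add: B_def norm_divide norm_power)
qed

text \<open>A substitute for Hadamard's three circles theorem: \<open>f(z)/z\<^sup>k\<close> is compared on \<open>1 \<le> |z| \<le> r\<^sup>a\<close>
  for the largest \<open>k\<close> for which the unit circle cannot carry the maximum.\<close>

lemma max_modulus_powr_ge:
  assumes f: "transcendental_entire f"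
  obtains r0 where "1 < r0" "\<And>r. r0 \<le> r \<Longrightarrow> r \<le> max_modulus f r"
    "\<And>r a. r0 \<le> r \<Longrightarrow> 1 \<le> a \<Longrightarrow> max_modulus f r powr (a / 2) \<le> max_modulus f (r powr a)"
proof -
  have hol: "f holomorphic_on UNIV" using f by (simp add: transcendental_entire_def)
  \<comment> \<open>The cube leaves room for \<open>(A * r)\<^sup>2 \<le> M\<close>, which pays for
    rounding the exponent to an integer below.\<close>
  obtain c where c: "0 < c" "\<And>r. 1 \<le> r \<Longrightarrow> c * r ^ 3 \<le> max_modulus f r"
    using transcendental_max_modulus_ge[OF f] by metis
  define A where "A = max 1 (max_modulus f 1)"
  have A: "1 \<le> A" by (simp add: A_def)
  define r0 where "r0 = max 2 (A\<^sup>2 / c)"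
  have ge: "(A * r)\<^sup>2 \<le> max_modulus f r" if r: "r0 \<le> r" for r
  proof -
    have "A\<^sup>2 \<le> c * r" using r c(1) by (simp add: r0_def field_simps)
    then have "A\<^sup>2 * r\<^sup>2 \<le> c * r * r\<^sup>2" by (intro mult_right_mono) auto
    also have "\<dots> \<le> max_modulus f r" using c(2)[of r] r by (simp add: r0_def power3_eq_cube power2_eq_square)
    finally show ?thesis by (simp add: power_mult_distrib)
  qed
  show ?thesis
  proof (rule that[of r0])
    show "1 < r0" by (simp add: r0_def)
    fix r assume r: "r0 \<le> r"
    then have r2: "2 \<le> r" by (simp add: r0_def)
    define M where "M = max_modulus f r"
    have Ar: "A * r \<ge> r" using A r2 mult_right_mono[of 1 A r] by simp
    have "1 \<le> A * r" using Ar r2 by linarith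
    then have "A * r * 1 \<le> A * r * (A * r)" by (intro mult_left_mono) auto
    then have ArM: "A * r \<le> M" using ge[OF r] by (simp add: M_def power2_eq_square)
    then show "r \<le> max_modulus f r" using Ar by (simp add: M_def)
    fix a :: real assume a: "1 \<le> a"
    define T where "T = r powr a"
    have T: "r \<le> T" using powr_mono[of 1 a r] a r2 by (simp add: T_def)
    have M0: "0 < M" "1 \<le> M" using ArM Ar r2 by linarith+
    have AM: "A < M"
    proof -
      have "A * 1 < A * r" using A r2 by (intro mult_strict_left_mono) auto
      with ArM show ?thesis by simp
    qed
    obtain n0 where "M / A < r ^ n0" using real_arch_pow[of r] r2 by auto
    then have ex: "\<exists>n. M \<le> A * r ^ n" using A by (intro exI[of _ n0]) (simp add: field_simps)
    \<comment> \<open>The ideal exponent is \<open>ln (M / A) / ln r\<close>, but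
      \<open>z ^ k\<close> needs an integer; \<open>k = N - 1\<close> still has
      \<open>A * r ^ k < M\<close>. Rounding can lose a factor \<open>r\<close>, yet
      \<open>r ^ k \<ge> sqrt M\<close> survives, whence the \<open>a / 2\<close> of the
      result.\<close>
    define N where "N = (LEAST n. M \<le> A * r ^ n)"
    have N: "M \<le> A * r ^ N" unfolding N_def by (rule LeastI_ex[OF ex])
    have "N \<noteq> 0" using N AM by (metis mult.right_neutral not_le power_0)
    then obtain k where k: "N = Suc k" by (cases N) auto
    have kM: "A * r ^ k < M" using not_less_Least[of k "\<lambda>n. M \<le> A * r ^ n"] k by (simp add: N_def)
    have "A * r * sqrt M \<le> sqrt M * sqrt M"
      using ge[OF r] M0 A r2 by (intro mult_right_mono real_le_rsqrt) (auto simp: M_def)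
    also have "\<dots> \<le> A * r * r ^ k" using N k M0 by (simp add: mult_ac)
    finally have sq: "sqrt M \<le> r ^ k"
      by (rule mult_left_le_imp_le) (use A r2 in simp)
    have "M / r ^ k \<le> max (max_modulus f 1) (max_modulus f T / T ^ k)"
      unfolding M_def by (rule max_modulus_annulus[OF hol _ T]) (use r2 in simp)
    moreover have "A < M / r ^ k" using kM r2 by (simp add: pos_less_divide_eq)
    then have "max_modulus f 1 < M / r ^ k" by (simp add: A_def)
    ultimately have "M / r ^ k \<le> max_modulus f T / T ^ k" by simp
    then have *: "M / r ^ k * T ^ k \<le> max_modulus f T"
      using T r2 by (simp add: pos_le_divide_eq)
    have "M powr (a / 2) \<le> M powr (1 + (a - 1) / 2)" using M0 by (intro powr_mono) (auto simp: field_simps)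
    also have "\<dots> = M * sqrt M powr (a - 1)"
      using M0 by (simp add: powr_add powr_powr flip: powr_half_sqrt)
    also have "\<dots> \<le> M * (r ^ k) powr (a - 1)"
      using sq M0 a by (intro mult_left_mono powr_mono2) auto
    also have "(r ^ k) powr (a - 1) = T ^ k / r ^ k"
      using r2 by (simp add: T_def powr_diff powr_powr powr_realpow[symmetric] mult.commute)
    finally show "max_modulus f r powr (a / 2) \<le> max_modulus f (r powr a)"
      using * by (simp add: M_def T_def)
  qed
qed

text \<open>Log-regularity says that \<open>ln (\<phi> t) - (1 + c) * ln t\<close> has a nonnegative
  right derivative for large \<open>t\<close>. Comparing \<open>t\<close> with \<open>a * t\<close>
  gives \<open>a powr (1 + c) * \<phi> t \<le> \<phi> (a * t)\<close>.\<close>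

lemma log_regular_max_modulus_powr:
  assumes lr: "log_regular_with c f"
  obtains r0 where "1 < r0"
    "\<And>r a. r0 \<le> r \<Longrightarrow> 1 \<le> a \<Longrightarrow> max_modulus f r powr (a powr (1 + c)) \<le> max_modulus f (r powr a)"
proof -
  have f: "transcendental_entire f" and c: "c > 0" using lr by (auto simp: log_regular_with_def)
  then have hol: "f holomorphic_on UNIV" by (simp add: transcendental_entire_def)
  obtain r1 where r1: "1 < r1" "\<And>r. r1 \<le> r \<Longrightarrow> r \<le> max_modulus f r"
    using max_modulus_powr_ge[OF f] by metis
  define \<phi> where "\<phi> = log_max_modulus_exp f"
  obtain T where T: "\<And>t. T \<le> t \<Longrightarrow> \<exists>D. (\<phi> has_real_derivative D) (at_right t) \<and> (1 + c) / t \<le> D / \<phi> t"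
    using lr unfolding log_regular_with_def \<phi>_def eventually_at_top_linorder by blast
  define T0 where "T0 = max T (max 1 (ln r1))"
  have M1: "1 < max_modulus f (exp t)" if "T0 \<le> t" for t
  proof -
    have "exp (ln r1) \<le> exp t" using that by (simp add: T0_def)
    then have "r1 \<le> exp t" using r1(1) by simp
    then show ?thesis using r1(2)[of "exp t"] r1(1) by linarith
  qed
  have \<phi>: "0 < \<phi> t" if "T0 \<le> t" for t
    using M1[OF that] by (simp add: \<phi>_def log_max_modulus_exp_def)
  have \<phi>_mono: "\<phi> s \<le> \<phi> t" if "T0 \<le> s" "s \<le> t" for s t
    using M1[of s] M1[of t] that max_modulus_mono[OF hol, of "exp s" "exp t"]
    by (simp add: \<phi>_def log_max_modulus_exp_def)
  have key: "a powr (1 + c) * \<phi> t \<le> \<phi> (a * t)" if t: "T0 \<le> t" and a: "1 \<le> a" for a t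
  proof -
    have t1: "1 \<le> t" using t by (simp add: T0_def)
    have tat: "t \<le> a * t" using a t1 mult_right_mono[of 1 a t] by simp
    have "ln (\<phi> t) - (1 + c) * ln t \<le> ln (\<phi> (a * t)) - (1 + c) * ln (a * t)"
    proof (rule right_derivative_nonneg_imp_le[OF tat])
      show "mono_on {t..a * t} (\<lambda>t. ln (\<phi> t))"
        using \<phi> \<phi>_mono t by (intro mono_onI) simp
      show "continuous_on {t..a * t} (\<lambda>t. (1 + c) * ln t)"
        using t1 by (intro continuous_intros) auto
      fix u assume u: "t \<le> u" "u < a * t"
      have Tu: "T \<le> u" "T0 \<le> u" using u t by (simp_all add: T0_def)
      obtain D where D: "(\<phi> has_real_derivative D) (at_right u)" "(1 + c) / u \<le> D / \<phi> u"
        using T[OF Tu(1)] by blast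
      have "((\<lambda>t. ln (\<phi> t) - (1 + c) * ln t) has_real_derivative D / \<phi> u - (1 + c) / u) (at_right u)"
        using \<phi>[OF Tu(2)] u t1 by (auto intro!: derivative_eq_intros D(1))
      then show "\<exists>D\<ge>0. ((\<lambda>t. ln (\<phi> t) - (1 + c) * ln t) has_real_derivative D) (at_right u)"
        using D(2) by (intro exI[of _ "D / \<phi> u - (1 + c) / u"]) simp
    qed
    then have "ln (a powr (1 + c) * \<phi> t) \<le> ln (\<phi> (a * t))"
      using a t1 \<phi>[OF t] by (simp add: ln_mult ln_powr algebra_simps)
    then show ?thesis using \<phi>[OF t] \<phi>[of "a * t"] tat t a by simp
  qed
  show ?thesis
  proof (rule that[of "exp T0"])
    show "1 < exp T0" by (simp add: T0_def)
    fix r a :: real assume r: "exp T0 \<le> r" and a: "1 \<le> a"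
    have "0 < r" using r exp_gt_zero[of T0] by linarith
    define t where "t = ln r"
    have t: "T0 \<le> t" "r = exp t" using r \<open>0 < r\<close> by (auto simp: t_def ln_ge_iff)
    have t1: "1 \<le> t" using t(1) by (simp add: T0_def)
    have tat: "t \<le> a * t" using a t1 mult_right_mono[of 1 a t] by simp
    have "max_modulus f r powr (a powr (1 + c)) = exp (a powr (1 + c) * \<phi> t)"
      using M1[OF t(1)] by (simp add: powr_def \<phi>_def log_max_modulus_exp_def t(2))
    also have "\<dots> \<le> exp (\<phi> (a * t))" using key[OF t(1) a] by simp
    also have "\<dots> = max_modulus f (r powr a)"
      using M1[of "a * t"] tat t(1) by (simp add: \<phi>_def log_max_modulus_exp_def powr_def t(2))
    finally show "max_modulus f r powr (a powr (1 + c)) \<le> max_modulus f (r powr a)" .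
  qed
qed

section \<open>Stretching of continua\<close>

text \<open>A connected set joining \<open>|z| \<le> r\<close> to \<open>|w| \<ge> r\<^sup>L\<close> has an image of the same kind, with \<open>L\<close>
  replaced by \<open>(L / K)\<^sup>1\<^sup>+\<^sup>c\<close>: the factor \<open>K\<close> is what the minimum modulus theorem loses, the
  exponent is what log-regularity gains. The inner end of the image is that of the same point \<open>z\<close>,
  so its orbit can be followed.\<close>

definition expands :: "real \<Rightarrow> (complex \<Rightarrow> complex) \<Rightarrow> bool" where
  "expands c f \<longleftrightarrow> (\<exists>K\<ge>1. \<exists>R>1. \<forall>r\<ge>R. \<forall>L\<ge>K. \<forall>\<Gamma> z w.
     connected \<Gamma> \<longrightarrow> z \<in> \<Gamma> \<longrightarrow> w \<in> \<Gamma> \<longrightarrow> norm z \<le> r \<longrightarrow> r powr L \<le> norm w \<longrightarrow>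
     (\<exists>r'\<ge>r. norm (f z) \<le> r' \<and> (\<exists>w'\<in>\<Gamma>. r' powr ((L / K) powr (1 + c)) \<le> norm (f w'))))"

lemma expandsE:
  assumes "expands c f"
  obtains K R where "1 \<le> K" "1 < R"
    "\<And>r L \<Gamma> z w. R \<le> r \<Longrightarrow> K \<le> L \<Longrightarrow> connected \<Gamma> \<Longrightarrow> z \<in> \<Gamma> \<Longrightarrow> w \<in> \<Gamma> \<Longrightarrow> norm z \<le> r \<Longrightarrow>
      r powr L \<le> norm w \<Longrightarrow>
      \<exists>r'\<ge>r. norm (f z) \<le> r' \<and> (\<exists>w'\<in>\<Gamma>. r' powr ((L / K) powr (1 + c)) \<le> norm (f w'))"
  using assms unfolding expands_def by metis

lemma expandsI:
  assumes "1 \<le> K" "1 < R"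
    "\<And>r L \<Gamma> z w. R \<le> r \<Longrightarrow> K \<le> L \<Longrightarrow> connected \<Gamma> \<Longrightarrow> z \<in> \<Gamma> \<Longrightarrow> w \<in> \<Gamma> \<Longrightarrow> norm z \<le> r \<Longrightarrow>
      r powr L \<le> norm w \<Longrightarrow>
      \<exists>r'\<ge>r. norm (f z) \<le> r' \<and> (\<exists>w'\<in>\<Gamma>. r' powr ((L / K) powr (1 + c)) \<le> norm (f w'))"
  shows "expands c f"
  using assms unfolding expands_def by blast

text \<open>For \<open>s = r powr (L / m)\<close> the minimum modulus theorem provides a circle with
  radius in \<open>[s, r powr L]\<close>, which \<open>\<Gamma>\<close> must cross. There
  \<open>|f|\<close> is at least the maximum modulus at \<open>s\<close>, while \<open>|f z|\<close>
  is at most that at \<open>r\<close>, which serves as \<open>r'\<close>; \<open>reg\<close> with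
  \<open>a = L / m\<close> compares the two.\<close>

lemma small_order_expands:
  assumes f: "transcendental_entire f" and order: "growth_order f < ereal (1 / 2)"
    and K0: "1 \<le> K0"
    and reg: "\<And>r a. r1 \<le> r \<Longrightarrow> K0 \<le> a \<Longrightarrow>
      max_modulus f r powr ((a / K0) powr (1 + c)) \<le> max_modulus f (r powr a)"
  shows "expands c f"
proof -
  have hol: "f holomorphic_on UNIV" using f by (simp add: transcendental_entire_def)
  obtain m r0 where m: "1 < m" "1 \<le> r0"
    and min: "\<And>r. r0 \<le> r \<Longrightarrow> \<exists>\<rho>. r \<le> \<rho> \<and> \<rho> \<le> r powr m \<and> (\<forall>z. norm z = \<rho> \<longrightarrow> max_modulus f r \<le> norm (f z))"
    using small_order_min_modulus[OF f order] by metis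
  obtain r2 where r2: "1 < r2" "\<And>r. r2 \<le> r \<Longrightarrow> r \<le> max_modulus f r"
    using max_modulus_powr_ge[OF f] by metis
  show ?thesis
  proof (rule expandsI[of "m * K0" "Max {r0, r1, r2}"])
    show "1 \<le> m * K0" using mult_mono[of 1 m 1 K0] m K0 by simp
    show "1 < Max {r0, r1, r2}" using r2 by simp
    fix r L :: real and \<Gamma> and z w :: complex
    assume r: "Max {r0, r1, r2} \<le> r" and L: "m * K0 \<le> L" and \<Gamma>: "connected \<Gamma>" "z \<in> \<Gamma>" "w \<in> \<Gamma>"
      and zw: "norm z \<le> r" "r powr L \<le> norm w"
    have r': "r0 \<le> r" "r1 \<le> r" "r2 \<le> r" "1 < r" using r r2 by auto
    define s where "s = r powr (L / m)"
    have Lm: "K0 \<le> L / m" using L m by (simp add: field_simps)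
    have "r powr 1 \<le> s" unfolding s_def using Lm K0 r' by (intro powr_mono) auto
    then have rs: "r \<le> s" using r' by simp
    have sL: "s powr m = r powr L" using m by (simp add: s_def powr_powr)
    obtain \<rho> where \<rho>: "s \<le> \<rho>" "\<rho> \<le> r powr L" "\<And>z. norm z = \<rho> \<Longrightarrow> max_modulus f s \<le> norm (f z)"
      using min[of s] rs r' sL by auto
    have "connected (norm ` \<Gamma>)"
      using \<Gamma>(1) by (intro connected_continuous_image continuous_intros)
    then have "\<rho> \<in> norm ` \<Gamma>"
      by (rule connectedD_interval[of _ "norm z" "norm w"]) (use \<Gamma> zw \<rho> rs in auto)
    then obtain w' where w': "w' \<in> \<Gamma>" "norm w' = \<rho>" by auto
    have "max_modulus f r powr ((L / (m * K0)) powr (1 + c)) \<le> max_modulus f s"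
      using reg[OF r'(2) Lm] by (simp add: s_def)
    also have "\<dots> \<le> norm (f w')" using \<rho>(3) w'(2) by blast
    finally show "\<exists>r'\<ge>r. norm (f z) \<le> r' \<and> (\<exists>w'\<in>\<Gamma>. r' powr ((L / (m * K0)) powr (1 + c)) \<le> norm (f w'))"
      using w'(1) r2(2)[OF r'(3)] norm_le_max_modulus[OF hol _ zw(1)] r'(4)
      by (intro exI[of _ "max_modulus f r"]) auto
  qed
qed

lemma expands_0:
  assumes f: "transcendental_entire f" and order: "growth_order f < ereal (1 / 2)"
  shows "expands 0 f"
proof -
  obtain r0 where r0: "1 < r0" "\<And>r a. r0 \<le> r \<Longrightarrow> 1 \<le> a \<Longrightarrow> max_modulus f r powr (a / 2) \<le> max_modulus f (r powr a)"
    using max_modulus_powr_ge[OF f] by metis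
  show ?thesis
    by (rule small_order_expands[OF f order, of 2 r0]) (use r0(2) in auto)
qed

lemma expands_log_regular:
  assumes lr: "log_regular_with c f" and order: "growth_order f < ereal (1 / 2)"
  shows "expands c f"
proof -
  have f: "transcendental_entire f" using lr by (simp add: log_regular_with_def)
  obtain r0 where r0: "1 < r0"
    "\<And>r a. r0 \<le> r \<Longrightarrow> 1 \<le> a \<Longrightarrow> max_modulus f r powr (a powr (1 + c)) \<le> max_modulus f (r powr a)"
    using log_regular_max_modulus_powr[OF lr] by metis
  show ?thesis
    by (rule small_order_expands[OF f order, of 1 r0]) (use r0(2) in auto)
qed

section \<open>Compositions and iterates of expanding maps\<close>

text \<open>The losses multiply to \<open>K1 * K2\<close>, and the gains to
  \<open>(1 + c1) * (1 + c2)\<close>, of which only \<open>1 + (c1 + c2)\<close> is kept. The loss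
  \<open>K2\<close> can be moved past the first power because
  \<open>K2 \<le> K2 powr (1 + c1)\<close>.\<close>

lemma expands_comp:
  assumes g: "expands c1 g" "continuous_on UNIV g" and f: "expands c2 f"
    and c: "0 \<le> c1" "0 \<le> c2"
  shows "expands (c1 + c2) (f \<circ> g)"
proof -
  obtain K1 R1 where 1: "1 \<le> K1" "1 < R1"
    "\<And>r L \<Gamma> z w. R1 \<le> r \<Longrightarrow> K1 \<le> L \<Longrightarrow> connected \<Gamma> \<Longrightarrow> z \<in> \<Gamma> \<Longrightarrow> w \<in> \<Gamma> \<Longrightarrow> norm z \<le> r \<Longrightarrow>
      r powr L \<le> norm w \<Longrightarrow>
      \<exists>r'\<ge>r. norm (g z) \<le> r' \<and> (\<exists>w'\<in>\<Gamma>. r' powr ((L / K1) powr (1 + c1)) \<le> norm (g w'))"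
    by (rule expandsE[OF g(1)]) (rule that; assumption)
  obtain K2 R2 where 2: "1 \<le> K2" "1 < R2"
    "\<And>r L \<Gamma> z w. R2 \<le> r \<Longrightarrow> K2 \<le> L \<Longrightarrow> connected \<Gamma> \<Longrightarrow> z \<in> \<Gamma> \<Longrightarrow> w \<in> \<Gamma> \<Longrightarrow> norm z \<le> r \<Longrightarrow>
      r powr L \<le> norm w \<Longrightarrow>
      \<exists>r'\<ge>r. norm (f z) \<le> r' \<and> (\<exists>w'\<in>\<Gamma>. r' powr ((L / K2) powr (1 + c2)) \<le> norm (f w'))"
    by (rule expandsE[OF f]) (rule that; assumption)
  show ?thesis
  proof (rule expandsI[of "K1 * K2" "max R1 R2"])
    show "1 \<le> K1 * K2" using mult_mono[of 1 K1 1 K2] 1 2 by simp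
    show "1 < max R1 R2" using 1 by simp
    fix r L :: real and \<Gamma> and z w :: complex
    assume r: "max R1 R2 \<le> r" and L: "K1 * K2 \<le> L" and \<Gamma>: "connected \<Gamma>" "z \<in> \<Gamma>" "w \<in> \<Gamma>"
      and zw: "norm z \<le> r" "r powr L \<le> norm w"
    define y where "y = L / (K1 * K2)"
    have y: "1 \<le> y" "L = y * (K1 * K2)" using L 1 2 by (auto simp: y_def)
    have LK: "L / K1 = y * K2" using y(2) 1 by simp
    have yK: "K2 \<le> y * K2" using y 2 mult_right_mono[of 1 y K2] by simp
    then have yK1: "1 \<le> y * K2" using 2(1) by linarith
    then have "1 \<le> L / K1" unfolding LK .
    then have "K1 \<le> L" using 1(1) by simp
    then obtain r' w' where r': "r \<le> r'" "norm (g z) \<le> r'" and w': "w' \<in> \<Gamma>"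
      "r' powr ((y * K2) powr (1 + c1)) \<le> norm (g w')"
      using 1(3)[of r L \<Gamma> z w] r \<Gamma> zw LK by auto
    define x where "x = (y * K2) powr (1 + c1)"
    have "(y * K2) powr 1 \<le> x" unfolding x_def using yK1 c by (intro powr_mono) auto
    then have x: "y * K2 \<le> x" using yK1 by simp
    then have K2x: "K2 \<le> x" using yK by simp
    have con: "connected (g ` \<Gamma>)"
      using \<Gamma>(1) g(2) continuous_on_subset by (intro connected_continuous_image) auto
    have "\<exists>r''\<ge>r'. norm (f (g z)) \<le> r'' \<and>
        (\<exists>w''\<in>g ` \<Gamma>. r'' powr ((x / K2) powr (1 + c2)) \<le> norm (f w''))"
      by (rule 2(3)[OF _ K2x con]) (use r r' \<Gamma> w' in \<open>auto simp: x_def\<close>)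
    then obtain r'' w'' where r'': "r' \<le> r''" "norm (f (g z)) \<le> r''" and w'': "w'' \<in> \<Gamma>"
      "r'' powr ((x / K2) powr (1 + c2)) \<le> norm (f (g w''))"
      by auto
    have "y powr (1 + c1) \<le> x / K2"
    proof -
      have "K2 powr 1 \<le> K2 powr (1 + c1)" using 2 c by (intro powr_mono) auto
      then have "y powr (1 + c1) * K2 \<le> y powr (1 + c1) * K2 powr (1 + c1)"
        using 2 by (intro mult_left_mono) auto
      then show ?thesis using 2 y by (simp add: x_def powr_mult pos_le_divide_eq)
    qed
    then have "(y powr (1 + c1)) powr (1 + c2) \<le> (x / K2) powr (1 + c2)"
      using c by (intro powr_mono2) auto
    moreover have "y powr (1 + (c1 + c2)) \<le> y powr ((1 + c1) * (1 + c2))"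
      using y c by (intro powr_mono) (auto simp: algebra_simps)
    ultimately have "y powr (1 + (c1 + c2)) \<le> (x / K2) powr (1 + c2)"
      by (simp add: powr_powr)
    then have "r'' powr (y powr (1 + (c1 + c2))) \<le> r'' powr ((x / K2) powr (1 + c2))"
      using r r' r'' 1 by (intro powr_mono) auto
    with w''(2) have "r'' powr ((L / (K1 * K2)) powr (1 + (c1 + c2))) \<le> norm (f (g w''))"
      by (simp add: y_def)
    then show "\<exists>r'\<ge>r. norm ((f \<circ> g) z) \<le> r' \<and>
        (\<exists>w'\<in>\<Gamma>. r' powr ((L / (K1 * K2)) powr (1 + (c1 + c2))) \<le> norm ((f \<circ> g) w'))"
      using r' r'' w'' by (intro exI[of _ r'']) auto
  qed
qed

lemma expands_id: "expands 0 id"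
  by (rule expandsI[of 1 2]) auto

lemma foldr_comp_holomorphic:
  assumes "\<And>f. f \<in> set fs \<Longrightarrow> f holomorphic_on UNIV"
  shows "foldr (\<circ>) fs id holomorphic_on UNIV"
  using assms
proof (induction fs)
  case Nil
  then show ?case by (simp add: id_def)
next
  case (Cons f fs)
  have G: "foldr (\<circ>) fs id holomorphic_on UNIV"
    by (rule Cons.IH) (rule Cons.prems, simp)
  have "f holomorphic_on foldr (\<circ>) fs id ` UNIV"
    using Cons.prems[of f] by (auto intro: holomorphic_on_subset)
  with G have "f \<circ> foldr (\<circ>) fs id holomorphic_on UNIV"
    by (rule holomorphic_on_compose)
  moreover have "foldr (\<circ>) (f # fs) id = f \<circ> foldr (\<circ>) fs id" by simp
  ultimately show ?case by (simp only:)
qed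

text \<open>One factor with \<open>c > 0\<close> suffices; the others contribute 0. The induction
  also carries \<open>expands 0\<close>, which is what the tail offers when the special factor is
  the head.\<close>

lemma foldr_comp_expands:
  assumes "\<And>f. f \<in> set fs \<Longrightarrow> f holomorphic_on UNIV" "\<And>f. f \<in> set fs \<Longrightarrow> expands 0 f"
    and c: "0 < c" "f \<in> set fs" "expands c f"
  shows "expands c (foldr (\<circ>) fs id)"
proof -
  have "expands 0 (foldr (\<circ>) fs id) \<and>
      (0 < c \<longrightarrow> f \<in> set fs \<longrightarrow> expands c f \<longrightarrow> expands c (foldr (\<circ>) fs id))"
    using assms(1,2)
  proof (induction fs)
    case Nil
    then show ?case using expands_id by (simp add: id_def)
  next
    case (Cons h fs)
    define G where "G = foldr (\<circ>) fs id"
    have eq: "foldr (\<circ>) (h # fs) id = h \<circ> G" unfolding G_def by simp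
    have "G holomorphic_on UNIV"
      unfolding G_def by (rule foldr_comp_holomorphic) (rule Cons.prems, simp)
    then have cont: "continuous_on UNIV G" by (rule holomorphic_on_imp_continuous_on)
    have "expands 0 G \<and> (0 < c \<longrightarrow> f \<in> set fs \<longrightarrow> expands c f \<longrightarrow> expands c G)"
      unfolding G_def by (rule Cons.IH) (rule Cons.prems, simp)+
    then have IH: "expands 0 G" "0 < c \<Longrightarrow> f \<in> set fs \<Longrightarrow> expands c f \<Longrightarrow> expands c G"
      by auto
    have h: "expands 0 h" using Cons.prems(2) by simp
    have "expands 0 (h \<circ> G)" using expands_comp[OF IH(1) cont h] by simp
    moreover have "expands c (h \<circ> G)" if "0 < c" "f \<in> set (h # fs)" "expands c f"
    proof (cases "f = h")
      case True
      then show ?thesis using expands_comp[OF IH(1) cont, of c h] that by simp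
    next
      case False
      then show ?thesis using expands_comp[OF IH(2) cont h] that by simp
    qed
    ultimately show ?case unfolding eq by blast
  qed
  with c show ?thesis by blast
qed

lemma funpow_holomorphic:
  assumes "g holomorphic_on UNIV"
  shows "(g ^^ n) holomorphic_on UNIV"
proof (induction n)
  case 0
  then show ?case by (simp add: id_def)
next
  case (Suc n)
  then have "g \<circ> (g ^^ n) holomorphic_on UNIV"
    using assms by (intro holomorphic_on_compose) (auto intro: holomorphic_on_subset)
  then show ?case by (simp only: funpow.simps)
qed

text \<open>A power above 1 beats division by \<open>K\<close>:
  \<open>(L / K) powr (1 + c) \<ge> 2 * L\<close> as soon as
  \<open>L \<ge> K * (2 * K) powr (1 / c)\<close>, so the exponent at least doubles. As
  \<open>r' \<ge> r\<close>, the threshold \<open>R\<close> serves every step.\<close>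

lemma expands_iterate:
  assumes g: "expands c g" and hol: "g holomorphic_on UNIV" and c: "0 < c"
  obtains R L where "1 < R" "1 \<le> L"
    "\<And>r \<Gamma> z w n. R \<le> r \<Longrightarrow> connected \<Gamma> \<Longrightarrow> z \<in> \<Gamma> \<Longrightarrow> w \<in> \<Gamma> \<Longrightarrow> norm z \<le> r \<Longrightarrow> r powr L \<le> norm w \<Longrightarrow>
      \<exists>r'\<ge>r. norm ((g ^^ n) z) \<le> r' \<and> (\<exists>w'\<in>\<Gamma>. r' powr (2 ^ n * L) \<le> norm ((g ^^ n) w'))"
proof -
  obtain K R where K: "1 \<le> K" "1 < R"
    "\<And>r L \<Gamma> z w. R \<le> r \<Longrightarrow> K \<le> L \<Longrightarrow> connected \<Gamma> \<Longrightarrow> z \<in> \<Gamma> \<Longrightarrow> w \<in> \<Gamma> \<Longrightarrow> norm z \<le> r \<Longrightarrow>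
      r powr L \<le> norm w \<Longrightarrow>
      \<exists>r'\<ge>r. norm (g z) \<le> r' \<and> (\<exists>w'\<in>\<Gamma>. r' powr ((L / K) powr (1 + c)) \<le> norm (g w'))"
    by (rule expandsE[OF g]) (rule that; assumption)
  define L0 where "L0 = K * (2 * K) powr (1 / c)"
  have pow1: "1 \<le> (2 * K) powr (1 / c)" using K c by (intro ge_one_powr_ge_zero) auto
  then have KL0: "K \<le> L0" using K mult_left_mono[of 1 _ K] by (simp add: L0_def)
  have dbl: "2 * L \<le> (L / K) powr (1 + c)" if L: "L0 \<le> L" for L
  proof -
    have LK1: "(2 * K) powr (1 / c) \<le> L / K"
      using L K(1) by (simp add: L0_def pos_le_divide_eq mult_ac)
    with pow1 have "0 < L / K" by linarith
    note LK = LK1 this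
    have "2 * K = ((2 * K) powr (1 / c)) powr c" using K c by (simp add: powr_powr)
    also have "\<dots> \<le> (L / K) powr c" using LK c by (intro powr_mono2) auto
    finally have "L / K * (2 * K) \<le> L / K * (L / K) powr c" using LK by (intro mult_left_mono) auto
    moreover have "L / K * (2 * K) = 2 * L" using K(1) by simp
    moreover have "(L / K) powr (1 + c) = L / K * (L / K) powr c"
      using LK(2) by (simp only: powr_add powr_one less_imp_le)
    ultimately show ?thesis by (simp only:)
  qed
  show ?thesis
  proof (rule that[of R L0])
    show "1 < R" "1 \<le> L0" using K KL0 by auto
    fix r :: real and \<Gamma> and z w :: complex and n :: nat
    assume r: "R \<le> r" and \<Gamma>: "connected \<Gamma>" "z \<in> \<Gamma>" "w \<in> \<Gamma>" and zw: "norm z \<le> r" "r powr L0 \<le> norm w"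
    show "\<exists>r'\<ge>r. norm ((g ^^ n) z) \<le> r' \<and> (\<exists>w'\<in>\<Gamma>. r' powr (2 ^ n * L0) \<le> norm ((g ^^ n) w'))"
    proof (induction n)
      case 0
      then show ?case using zw \<Gamma> by auto
    next
      case (Suc n)
      then obtain r' w' where r': "r \<le> r'" "norm ((g ^^ n) z) \<le> r'" and w': "w' \<in> \<Gamma>"
        "r' powr (2 ^ n * L0) \<le> norm ((g ^^ n) w')" by auto
      have L: "L0 \<le> 2 ^ n * L0" using KL0 K mult_right_mono[of 1 "2 ^ n" L0] by simp
      have con: "connected ((g ^^ n) ` \<Gamma>)"
        by (rule connected_continuous_image[OF continuous_on_subset[OF
              holomorphic_on_imp_continuous_on[OF funpow_holomorphic[OF hol]] subset_UNIV] \<Gamma>(1)])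
      have "\<exists>r''\<ge>r'. norm (g ((g ^^ n) z)) \<le> r'' \<and>
          (\<exists>w''\<in>(g ^^ n) ` \<Gamma>. r'' powr ((2 ^ n * L0 / K) powr (1 + c)) \<le> norm (g w''))"
        by (rule K(3)[OF _ _ con _ _ r'(2) w'(2)]) (use r r' L KL0 \<Gamma> w' in auto)
      then obtain r'' w'' where r'': "r' \<le> r''" "norm (g ((g ^^ n) z)) \<le> r''" and w'': "w'' \<in> \<Gamma>"
        "r'' powr ((2 ^ n * L0 / K) powr (1 + c)) \<le> norm (g ((g ^^ n) w''))" by auto
      have "r'' powr (2 * (2 ^ n * L0)) \<le> r'' powr ((2 ^ n * L0 / K) powr (1 + c))"
        using dbl[OF L] r r' r'' K by (intro powr_mono) auto
      with w''(2) have "r'' powr (2 ^ Suc n * L0) \<le> norm ((g ^^ Suc n) w'')" by (simp add: mult_ac)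
      then show ?case using r' r'' w''(1) by (intro exI[of _ r'']) auto
    qed
  qed
qed

section \<open>Fatou components\<close>

lemma open_Fatou_set: "open (Fatou_set g)"
proof (subst open_subopen, intro ballI)
  fix z assume "z \<in> Fatou_set g"
  then obtain U where "open U" "connected U" "z \<in> U" "normal_family_on U {g ^^ n |n. n \<ge> 1}"
    unfolding Fatou_set_def by blast
  then show "\<exists>T. open T \<and> z \<in> T \<and> T \<subseteq> Fatou_set g"
    unfolding Fatou_set_def by (intro exI[of _ U]) blast
qed

text \<open>Nothing is known about \<open>h\<close> itself, so the comparison goes through one fixed
  \<open>F N\<close>, bounded by continuity; two errors of size 1 make the 2.\<close>

lemma uniform_limit_eventually_bounded:
  fixes F :: "nat \<Rightarrow> complex \<Rightarrow> complex"
  assumes lim: "uniform_limit K F h sequentially" and K: "compact K"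
    and cont: "\<And>n. continuous_on K (F n)"
  obtains B where "\<forall>\<^sub>F n in sequentially. \<forall>w\<in>K. norm (F n w) \<le> B"
proof -
  have ev: "\<forall>\<^sub>F n in sequentially. \<forall>w\<in>K. dist (F n w) (h w) < 1"
    using uniform_limitD[OF lim zero_less_one] .
  then obtain N where N: "\<And>w. w \<in> K \<Longrightarrow> dist (F N w) (h w) < 1"
    unfolding eventually_sequentially by blast
  have "bounded (F N ` K)"
    using K cont by (intro compact_imp_bounded compact_continuous_image)
  then obtain B where B: "\<And>w. w \<in> K \<Longrightarrow> norm (F N w) \<le> B"
    unfolding bounded_iff by blast
  have "\<forall>\<^sub>F n in sequentially. \<forall>w\<in>K. norm (F n w) \<le> B + 2"
    using ev
  proof eventually_elim
    case (elim n)
    show ?case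
    proof
      fix w assume w: "w \<in> K"
      have "dist (F n w) (F N w) \<le> dist (F n w) (h w) + dist (F N w) (h w)"
        by (rule dist_triangle2)
      also have "\<dots> \<le> 2" using elim w N[OF w] by fastforce
      finally have "norm (F n w - F N w) \<le> 2" by (simp add: dist_norm)
      then show "norm (F n w) \<le> B + 2"
        using norm_triangle_sub[of "F n w" "F N w"] B[OF w] by linarith
    qed
  qed
  with that show ?thesis by blast
qed

text \<open>A Fatou component carrying iterates that are unbounded at moving points of a compact set
  carries, along a subsequence, iterates that tend to infinity locally uniformly, and then
  Harnack's inequality makes the logarithms of their moduli comparable.\<close>

lemma fatou_component_log_modulus_comparable:
  assumes hol: "g holomorphic_on UNIV" and D: "D \<in> components (Fatou_set g)"
    and \<Gamma>: "compact \<Gamma>" "\<Gamma> \<subseteq> D" and z0: "z0 \<in> D"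
    and \<zeta>: "\<And>n. \<zeta> n \<in> \<Gamma>" and inf: "filterlim (\<lambda>n. norm ((g ^^ n) (\<zeta> n))) at_top sequentially"
  obtains \<sigma> C where "strict_mono (\<sigma> :: nat \<Rightarrow> nat)" "0 < C"
    "\<forall>\<^sub>F n in sequentially. 1 < norm ((g ^^ \<sigma> n) z0) \<and>
       ln (norm ((g ^^ \<sigma> n) (\<zeta> (\<sigma> n)))) \<le> C * ln (norm ((g ^^ \<sigma> n) z0))"
proof -
  have opD: "open D" using open_components[OF open_Fatou_set D] .
  have conD: "connected D" using in_components_connected[OF D] .
  have Shol: "(g ^^ n) holomorphic_on T" for n T
    using funpow_holomorphic[OF hol] by (rule holomorphic_on_subset) simp
  have Scont: "continuous_on T (g ^^ n)" for n T
    using Shol by (rule holomorphic_on_imp_continuous_on)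
  \<comment> \<open>Normality in usable form: on a disc around \<open>z\<close>, every sequence of
    iterates with increasing indices has a subsequence that is uniformly bounded or tends uniformly
    to infinity.\<close>
  have dich: "\<exists>\<delta>>0. cball z \<delta> \<subseteq> D \<and> (\<forall>\<sigma> :: nat \<Rightarrow> nat. strict_mono \<sigma> \<longrightarrow> (\<exists>\<tau> :: nat \<Rightarrow> nat. strict_mono \<tau> \<and>
      ((\<exists>B. \<forall>\<^sub>F n in sequentially. \<forall>w\<in>cball z \<delta>. norm ((g ^^ \<sigma> (\<tau> n)) w) \<le> B) \<or>
       (\<forall>B. \<forall>\<^sub>F n in sequentially. \<forall>w\<in>cball z \<delta>. norm ((g ^^ \<sigma> (\<tau> n)) w) > B))))"
    if z: "z \<in> D" for z
  proof -
    have "z \<in> Fatou_set g" using in_components_subset[OF D] z by blast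
    then obtain U where U: "open U" "z \<in> U" "normal_family_on U {g ^^ n |n. n \<ge> 1}"
      unfolding Fatou_set_def by blast
    obtain \<delta> where \<delta>: "\<delta> > 0" "cball z \<delta> \<subseteq> U \<inter> D"
      using open_contains_cball[of "U \<inter> D"] U z opD by blast
    have "\<exists>\<tau> :: nat \<Rightarrow> nat. strict_mono \<tau> \<and>
      ((\<exists>B. \<forall>\<^sub>F n in sequentially. \<forall>w\<in>cball z \<delta>. norm ((g ^^ \<sigma> (\<tau> n)) w) \<le> B) \<or>
       (\<forall>B. \<forall>\<^sub>F n in sequentially. \<forall>w\<in>cball z \<delta>. norm ((g ^^ \<sigma> (\<tau> n)) w) > B))"
      if \<sigma>: "strict_mono \<sigma>" for \<sigma> :: "nat \<Rightarrow> nat"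
    proof -
      \<comment> \<open>The family starts at \<open>n = 1\<close> while \<open>\<sigma> 0\<close>
        may be 0; the shift drops that term.\<close>
      define s where "s n = g ^^ \<sigma> (Suc n)" for n
      have "\<sigma> (Suc n) \<ge> 1" for n using seq_suble[OF \<sigma>, of "Suc n"] by simp
      then have "range s \<subseteq> {g ^^ n |n. n \<ge> 1}" unfolding s_def by blast
      then obtain \<tau> where \<tau>: "strict_mono \<tau>" "(\<exists>h. \<forall>K. compact K \<and> K \<subseteq> U \<longrightarrow> uniform_limit K (s \<circ> \<tau>) h sequentially) \<or>
            (\<forall>K. compact K \<and> K \<subseteq> U \<longrightarrow> (\<forall>B. \<forall>\<^sub>F n in sequentially. \<forall>z\<in>K. norm (s (\<tau> n) z) > B))"
        using U(3) unfolding normal_family_on_def by blast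
      have K: "compact (cball z \<delta>)" "cball z \<delta> \<subseteq> U" using \<delta> by auto
      have mono: "strict_mono (Suc \<circ> \<tau>)" using \<tau>(1) by (simp add: strict_mono_def)
      from \<tau>(2) have "(\<exists>B. \<forall>\<^sub>F n in sequentially. \<forall>w\<in>cball z \<delta>. norm (s (\<tau> n) w) \<le> B) \<or>
          (\<forall>B. \<forall>\<^sub>F n in sequentially. \<forall>w\<in>cball z \<delta>. norm (s (\<tau> n) w) > B)"
      proof
        assume "\<exists>h. \<forall>K. compact K \<and> K \<subseteq> U \<longrightarrow> uniform_limit K (s \<circ> \<tau>) h sequentially"
        then obtain h where ul: "uniform_limit (cball z \<delta>) (s \<circ> \<tau>) h sequentially" using K by blast
        have "continuous_on (cball z \<delta>) ((s \<circ> \<tau>) n)" for n by (simp add: s_def Scont)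
        then obtain B where "\<forall>\<^sub>F n in sequentially. \<forall>w\<in>cball z \<delta>. norm ((s \<circ> \<tau>) n w) \<le> B"
          by (rule uniform_limit_eventually_bounded[OF ul K(1)])
        then show ?thesis by auto
      next
        assume "\<forall>K. compact K \<and> K \<subseteq> U \<longrightarrow> (\<forall>B. \<forall>\<^sub>F n in sequentially. \<forall>z\<in>K. norm (s (\<tau> n) z) > B)"
        then show ?thesis using K by blast
      qed
      with mono show ?thesis by (intro exI[of _ "Suc \<circ> \<tau>"]) (simp add: s_def)
    qed
    with \<delta> show ?thesis by blast
  qed
  obtain \<zeta>' \<sigma>0 where \<zeta>': "\<zeta>' \<in> \<Gamma>" and \<sigma>0: "strict_mono \<sigma>0" and lim0: "(\<zeta> \<circ> \<sigma>0) \<longlonglongrightarrow> \<zeta>'"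
    using seq_compactE[OF compact_imp_seq_compact[OF \<Gamma>(1)]] \<zeta> by metis
  have \<zeta>'D: "\<zeta>' \<in> D" using \<zeta>' \<Gamma> by blast
  define blowup where "blowup \<sigma> z \<longleftrightarrow>
    (\<exists>\<delta>>0. \<forall>B. \<forall>\<^sub>F n in sequentially. \<forall>w\<in>cball z \<delta>. norm ((g ^^ \<sigma> n) w) > B)" for \<sigma> :: "nat \<Rightarrow> nat" and z
  obtain \<sigma> where \<sigma>: "strict_mono \<sigma>" "(\<zeta> \<circ> \<sigma>) \<longlonglongrightarrow> \<zeta>'" "blowup \<sigma> \<zeta>'"
  proof -
    obtain \<delta> where \<delta>: "\<delta> > 0" and d: "\<And>\<sigma> :: nat \<Rightarrow> nat. strict_mono \<sigma> \<Longrightarrow> \<exists>\<tau> :: nat \<Rightarrow> nat. strict_mono \<tau> \<and>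
        ((\<exists>B. \<forall>\<^sub>F n in sequentially. \<forall>w\<in>cball \<zeta>' \<delta>. norm ((g ^^ \<sigma> (\<tau> n)) w) \<le> B) \<or>
         (\<forall>B. \<forall>\<^sub>F n in sequentially. \<forall>w\<in>cball \<zeta>' \<delta>. norm ((g ^^ \<sigma> (\<tau> n)) w) > B))"
      using dich[OF \<zeta>'D] by blast
    obtain \<tau> where \<tau>: "strict_mono \<tau>"
      "(\<exists>B. \<forall>\<^sub>F n in sequentially. \<forall>w\<in>cball \<zeta>' \<delta>. norm ((g ^^ \<sigma>0 (\<tau> n)) w) \<le> B) \<or>
       (\<forall>B. \<forall>\<^sub>F n in sequentially. \<forall>w\<in>cball \<zeta>' \<delta>. norm ((g ^^ \<sigma>0 (\<tau> n)) w) > B)"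
      using d[OF \<sigma>0] by blast
    define \<sigma> where "\<sigma> = \<sigma>0 \<circ> \<tau>"
    have \<sigma>: "strict_mono \<sigma>" unfolding \<sigma>_def using \<sigma>0 \<tau>(1) by (rule strict_mono_o)
    have lim: "(\<zeta> \<circ> \<sigma>) \<longlonglongrightarrow> \<zeta>'"
      using LIMSEQ_subseq_LIMSEQ[OF lim0 \<tau>(1)] by (simp add: \<sigma>_def o_assoc)
    \<comment> \<open>The moving points \<open>\<zeta> (\<sigma> n)\<close> end up in this disc, and
      the iterates there exceed every bound.\<close>
    have "\<not> (\<exists>B. \<forall>\<^sub>F n in sequentially. \<forall>w\<in>cball \<zeta>' \<delta>. norm ((g ^^ \<sigma> n) w) \<le> B)"
    proof
      assume "\<exists>B. \<forall>\<^sub>F n in sequentially. \<forall>w\<in>cball \<zeta>' \<delta>. norm ((g ^^ \<sigma> n) w) \<le> B"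
      then obtain B where B: "\<forall>\<^sub>F n in sequentially. \<forall>w\<in>cball \<zeta>' \<delta>. norm ((g ^^ \<sigma> n) w) \<le> B" by blast
      have "filterlim (\<lambda>n. norm ((g ^^ \<sigma> n) (\<zeta> (\<sigma> n)))) at_top sequentially"
        using filterlim_compose[OF inf filterlim_subseq[OF \<sigma>]] .
      then have "\<forall>\<^sub>F n in sequentially. B < norm ((g ^^ \<sigma> n) (\<zeta> (\<sigma> n)))"
        by (simp add: filterlim_at_top_dense)
      moreover have "\<forall>\<^sub>F n in sequentially. dist (\<zeta> (\<sigma> n)) \<zeta>' < \<delta>"
        using tendstoD[OF lim \<delta>] by simp
      ultimately have "\<forall>\<^sub>F n in sequentially. False"
        using B
      proof eventually_elim
        case (elim n)
        have "\<zeta> (\<sigma> n) \<in> cball \<zeta>' \<delta>" using elim(2) by (simp add: dist_commute)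
        with elim(1,3) show False by fastforce
      qed
      then show False by simp
    qed
    with \<tau>(2) have "blowup \<sigma> \<zeta>'" unfolding blowup_def \<sigma>_def using \<delta> by auto
    with that \<sigma> lim show ?thesis by blast
  qed
  have blowup: "blowup \<sigma> z" if z: "z \<in> D" for z
  proof -
    have "blowup \<sigma> \<zeta>' \<longleftrightarrow> blowup \<sigma> z"
    proof (rule connected_equivalence_relation[OF conD \<zeta>'D z])
      fix a assume a: "a \<in> D"
      obtain \<delta> where \<delta>: "\<delta> > 0" "cball a \<delta> \<subseteq> D" and d: "\<And>\<sigma> :: nat \<Rightarrow> nat. strict_mono \<sigma> \<Longrightarrow> \<exists>\<tau> :: nat \<Rightarrow> nat. strict_mono \<tau> \<and>
          ((\<exists>B. \<forall>\<^sub>F n in sequentially. \<forall>w\<in>cball a \<delta>. norm ((g ^^ \<sigma> (\<tau> n)) w) \<le> B) \<or>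
           (\<forall>B. \<forall>\<^sub>F n in sequentially. \<forall>w\<in>cball a \<delta>. norm ((g ^^ \<sigma> (\<tau> n)) w) > B))"
        using dich[OF a] by blast
      \<comment> \<open>Indices where this fails would form a sequence to which normality applies: a
        bounded subsequence contradicts the blow-up at \<open>x\<close>, one tending to infinity
        contradicts the failure.\<close>
      have spread: "\<forall>\<^sub>F n in sequentially. \<forall>w\<in>cball a \<delta>. norm ((g ^^ \<sigma> n) w) > B"
        if x: "x \<in> ball a \<delta>" "blowup \<sigma> x" for x B
      proof (rule ccontr)
        assume "\<not> ?thesis"
        from not_eventually_sequentiallyD[OF this] obtain \<tau>1 :: "nat \<Rightarrow> nat" where \<tau>1: "strict_mono \<tau>1"
          "\<And>n. \<not> (\<forall>w\<in>cball a \<delta>. norm ((g ^^ \<sigma> (\<tau>1 n)) w) > B)"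
          by blast
        obtain \<tau>2 where \<tau>2: "strict_mono \<tau>2"
          "(\<exists>B. \<forall>\<^sub>F n in sequentially. \<forall>w\<in>cball a \<delta>. norm ((g ^^ \<sigma> (\<tau>1 (\<tau>2 n))) w) \<le> B) \<or>
           (\<forall>B. \<forall>\<^sub>F n in sequentially. \<forall>w\<in>cball a \<delta>. norm ((g ^^ \<sigma> (\<tau>1 (\<tau>2 n))) w) > B)"
          using d[OF strict_mono_o[OF \<sigma>(1) \<tau>1(1)]] by auto
        from \<tau>2(2) have "\<forall>\<^sub>F n in sequentially. False"
        proof
          assume "\<exists>B. \<forall>\<^sub>F n in sequentially. \<forall>w\<in>cball a \<delta>. norm ((g ^^ \<sigma> (\<tau>1 (\<tau>2 n))) w) \<le> B"
          then obtain B' where B': "\<forall>\<^sub>F n in sequentially. \<forall>w\<in>cball a \<delta>. norm ((g ^^ \<sigma> (\<tau>1 (\<tau>2 n))) w) \<le> B'"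
            by blast
          obtain e where e: "e > 0"
            "\<forall>\<^sub>F n in sequentially. \<forall>w\<in>cball x e. norm ((g ^^ \<sigma> n) w) > B'"
            using x(2) unfolding blowup_def by blast
          have "\<forall>\<^sub>F n in sequentially. \<forall>w\<in>cball x e. norm ((g ^^ \<sigma> ((\<tau>1 \<circ> \<tau>2) n)) w) > B'"
            by (rule eventually_subseq[OF strict_mono_o[OF \<tau>1(1) \<tau>2(1)] e(2)])
          with B' show ?thesis
          proof eventually_elim
            case (elim n)
            have "x \<in> cball a \<delta>" "x \<in> cball x e" using x(1) e(1) by auto
            with elim show False by fastforce
          qed
        next
          assume "\<forall>B. \<forall>\<^sub>F n in sequentially. \<forall>w\<in>cball a \<delta>. norm ((g ^^ \<sigma> (\<tau>1 (\<tau>2 n))) w) > B"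
          then have "\<forall>\<^sub>F n in sequentially. \<forall>w\<in>cball a \<delta>. norm ((g ^^ \<sigma> (\<tau>1 (\<tau>2 n))) w) > B" by blast
          then show ?thesis by (rule eventually_mono) (use \<tau>1(2) in blast)
        qed
        then show False by simp
      qed
      have all: "blowup \<sigma> y" if x: "x \<in> ball a \<delta>" "blowup \<sigma> x" and y: "y \<in> ball a \<delta>" for x y
      proof -
        obtain e where e: "e > 0" "cball y e \<subseteq> ball a \<delta>"
          using y open_contains_cball[of "ball a \<delta>"] open_ball by blast
        have "\<forall>\<^sub>F n in sequentially. \<forall>w\<in>cball y e. norm ((g ^^ \<sigma> n) w) > B" for B
          using spread[OF x, of B] by (rule eventually_mono) (use e in force)
        with e(1) show ?thesis unfolding blowup_def by blast
      qed
      have aa: "a \<in> ball a \<delta>" using \<delta> by simp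
      have "ball a \<delta> \<subseteq> D" using \<delta>(2) ball_subset_cball[of a \<delta>] by blast
      then have "openin (top_of_set D) (ball a \<delta>)" using opD by (simp add: openin_open_eq)
      with aa show "\<exists>T. openin (top_of_set D) T \<and> a \<in> T \<and> (\<forall>x\<in>T. blowup \<sigma> a \<longleftrightarrow> blowup \<sigma> x)"
        using all by (intro exI[of _ "ball a \<delta>"]) blast
    qed auto
    with \<sigma>(3) show ?thesis by simp
  qed
  have gt1: "\<exists>\<delta>>0. \<forall>\<^sub>F n in sequentially. \<forall>w\<in>cball z \<delta>. norm ((g ^^ \<sigma> n) w) > 1" if "z \<in> D" for z
    using blowup[OF that] unfolding blowup_def by blast
  have harn: "ln (norm ((g ^^ m) b)) \<le> 3 * ln (norm ((g ^^ m) a))"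
    if "\<delta> > 0" "\<forall>w\<in>cball a \<delta>. norm ((g ^^ m) w) > 1" "dist a b \<le> \<delta> / 2" for m a b \<delta>
    by (rule harnack[OF Shol that(1) _ that(3)]) (use that(2) in auto)
  \<comment> \<open>Finite Harnack chains multiply the constants, so \<open>C\<close> is independent
    of \<open>n\<close>. \<open>Q\<close> is not symmetric by definition, hence the connectedness
    argument runs with both directions.\<close>
  define Q where "Q x y \<longleftrightarrow> (\<exists>C>0. \<forall>\<^sub>F n in sequentially.
      ln (norm ((g ^^ \<sigma> n) x)) \<le> C * ln (norm ((g ^^ \<sigma> n) y)))" for x y
  have Qtrans: "Q x z" if xy: "Q x y" and yz: "Q y z" for x y z
  proof -
    obtain C1 where C1: "C1 > 0"
      "\<forall>\<^sub>F n in sequentially. ln (norm ((g ^^ \<sigma> n) x)) \<le> C1 * ln (norm ((g ^^ \<sigma> n) y))"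
      using xy unfolding Q_def by blast
    obtain C2 where C2: "C2 > 0"
      "\<forall>\<^sub>F n in sequentially. ln (norm ((g ^^ \<sigma> n) y)) \<le> C2 * ln (norm ((g ^^ \<sigma> n) z))"
      using yz unfolding Q_def by blast
    have "\<forall>\<^sub>F n in sequentially. ln (norm ((g ^^ \<sigma> n) x)) \<le> C1 * C2 * ln (norm ((g ^^ \<sigma> n) z))"
      using C1(2) C2(2)
    proof eventually_elim
      case (elim n)
      have "C1 * ln (norm ((g ^^ \<sigma> n) y)) \<le> C1 * (C2 * ln (norm ((g ^^ \<sigma> n) z)))"
        using elim(2) C1(1) by (intro mult_left_mono) auto
      with elim(1) show ?case by (simp only: mult.assoc)
    qed
    moreover have "C1 * C2 > 0" using C1 C2 by simp
    ultimately show ?thesis unfolding Q_def by blast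
  qed
  have "Q \<zeta>' z0 \<and> Q z0 \<zeta>'"
  proof (rule connected_equivalence_relation[OF conD \<zeta>'D z0])
    show "Q x z \<and> Q z x" if "Q x y \<and> Q y x" "Q y z \<and> Q z y" for x y z
      using Qtrans that by blast
    fix a assume a: "a \<in> D"
    obtain \<delta> where \<delta>: "\<delta> > 0" and ev: "\<forall>\<^sub>F n in sequentially. \<forall>w\<in>cball a \<delta>. norm ((g ^^ \<sigma> n) w) > 1"
      using gt1[OF a] by blast
    \<comment> \<open>With radius \<open>\<delta> / 4\<close> the centre \<open>a\<close> also lies
      in the inner half of \<open>cball x (\<delta> / 2)\<close>, which is still inside
      \<open>cball a \<delta>\<close>; so Harnack works both ways.\<close>
    have "Q a x \<and> Q x a" if x: "x \<in> ball a (\<delta> / 4)" for x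
    proof -
      have "dist a x < \<delta> / 4" using x by simp
      then have ax: "dist a x \<le> \<delta> / 2" "dist x a \<le> \<delta> / 2 / 2"
        using \<delta> dist_commute[of a x] by linarith+
      have sub: "cball x (\<delta> / 2) \<subseteq> cball a \<delta>"
      proof
        fix y assume "y \<in> cball x (\<delta> / 2)"
        then show "y \<in> cball a \<delta>" using ax(1) dist_triangle[of a y x] by simp
      qed
      have "\<forall>\<^sub>F n in sequentially. ln (norm ((g ^^ \<sigma> n) x)) \<le> 3 * ln (norm ((g ^^ \<sigma> n) a))"
        using ev by (rule eventually_mono) (rule harn[OF \<delta> _ ax(1)])
      moreover have "\<forall>\<^sub>F n in sequentially. ln (norm ((g ^^ \<sigma> n) a)) \<le> 3 * ln (norm ((g ^^ \<sigma> n) x))"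
        using ev by (rule eventually_mono) (rule harn[OF _ _ ax(2)], use \<delta> sub in auto)
      ultimately show ?thesis unfolding Q_def by (intro conjI exI[of _ 3]) auto
    qed
    moreover have "openin (top_of_set D) (D \<inter> ball a (\<delta> / 4))" by (intro openin_open_Int) simp
    ultimately show "\<exists>T. openin (top_of_set D) T \<and> a \<in> T \<and> (\<forall>x\<in>T. Q a x \<and> Q x a)"
      using a \<delta> by (intro exI[of _ "D \<inter> ball a (\<delta> / 4)"]) auto
  qed auto
  then obtain C where C: "C > 0"
    "\<forall>\<^sub>F n in sequentially. ln (norm ((g ^^ \<sigma> n) \<zeta>')) \<le> C * ln (norm ((g ^^ \<sigma> n) z0))"
    unfolding Q_def by blast
  obtain \<delta> where \<delta>: "\<delta> > 0" and ev: "\<forall>\<^sub>F n in sequentially. \<forall>w\<in>cball \<zeta>' \<delta>. norm ((g ^^ \<sigma> n) w) > 1"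
    using gt1[OF \<zeta>'D] by blast
  obtain \<delta>0 where \<delta>0: "\<delta>0 > 0" and ev0: "\<forall>\<^sub>F n in sequentially. \<forall>w\<in>cball z0 \<delta>0. norm ((g ^^ \<sigma> n) w) > 1"
    using gt1[OF z0] by blast
  have near: "\<forall>\<^sub>F n in sequentially. dist (\<zeta> (\<sigma> n)) \<zeta>' < \<delta> / 2"
    using tendstoD[OF \<sigma>(2), of "\<delta> / 2"] \<delta> by simp
  have "\<forall>\<^sub>F n in sequentially. 1 < norm ((g ^^ \<sigma> n) z0) \<and>
       ln (norm ((g ^^ \<sigma> n) (\<zeta> (\<sigma> n)))) \<le> 3 * C * ln (norm ((g ^^ \<sigma> n) z0))"
    using near ev ev0 C(2)
  proof eventually_elim
    case (elim n)
    have "ln (norm ((g ^^ \<sigma> n) (\<zeta> (\<sigma> n)))) \<le> 3 * ln (norm ((g ^^ \<sigma> n) \<zeta>'))"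
      using elim(1) by (intro harn[OF \<delta> elim(2)]) (simp add: dist_commute)
    moreover have "1 < norm ((g ^^ \<sigma> n) z0)" using elim(3) \<delta>0 by simp
    ultimately show ?case using elim(4) by simp
  qed
  with that[of \<sigma> "3 * C"] \<sigma>(1) C(1) show ?thesis by simp
qed

text \<open>Along a path in \<open>D\<close> from \<open>z0\<close> to a far point,
  \<open>ln |g^n|\<close> at \<open>\<zeta> n\<close> is at least
  \<open>2 ^ n * L * ln (\<rho> n)\<close>, and \<open>\<rho> n \<ge> |g^n z0|\<close>.
  Comparability along \<open>\<sigma>\<close> with a fixed \<open>C\<close> would force
  \<open>2 ^ \<sigma> n * L \<le> C\<close> for all large \<open>n\<close>.\<close>

lemma expands_imp_Fatou_component_bounded:
  assumes g: "expands c g" and hol: "g holomorphic_on UNIV" and c: "0 < c"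
    and D: "D \<in> components (Fatou_set g)"
  shows "bounded D"
proof (rule ccontr)
  assume unb: "\<not> bounded D"
  obtain R L where RL: "1 < R" "1 \<le> L"
    "\<And>r \<Gamma> z w n. R \<le> r \<Longrightarrow> connected \<Gamma> \<Longrightarrow> z \<in> \<Gamma> \<Longrightarrow> w \<in> \<Gamma> \<Longrightarrow> norm z \<le> r \<Longrightarrow> r powr L \<le> norm w \<Longrightarrow>
      \<exists>r'\<ge>r. norm ((g ^^ n) z) \<le> r' \<and> (\<exists>w'\<in>\<Gamma>. r' powr (2 ^ n * L) \<le> norm ((g ^^ n) w'))"
    by (rule expands_iterate[OF g hol c]) (rule that; assumption)
  have opD: "open D" using open_components[OF open_Fatou_set D] .
  have conD: "connected D" using in_components_connected[OF D] .
  obtain z0 where z0: "z0 \<in> D" using in_components_nonempty[OF D] by blast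
  define r where "r = max R (norm z0)"
  obtain w where w: "w \<in> D" "r powr L \<le> norm w"
    using unb unfolding bounded_iff by (meson linear)
  have "path_connected D" using connected_open_path_connected[OF opD conD] .
  then obtain p where p: "path p" "path_image p \<subseteq> D" "pathstart p = z0" "pathfinish p = w"
    using z0 w(1) unfolding path_connected_def by metis
  define \<Gamma> where "\<Gamma> = path_image p"
  have \<Gamma>: "compact \<Gamma>" "connected \<Gamma>" "\<Gamma> \<subseteq> D" "z0 \<in> \<Gamma>" "w \<in> \<Gamma>"
    using p pathstart_in_path_image[of p] pathfinish_in_path_image[of p]
    by (auto simp: \<Gamma>_def compact_path_image connected_path_image)
  have "\<exists>r' w'. r \<le> r' \<and> norm ((g ^^ n) z0) \<le> r' \<and> w' \<in> \<Gamma> \<and> r' powr (2 ^ n * L) \<le> norm ((g ^^ n) w')" for n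
    using RL(3)[of r \<Gamma> z0 w n] \<Gamma> w(2) unfolding r_def by auto
  then obtain \<rho> \<zeta> where \<rho>: "\<And>n. r \<le> \<rho> n" "\<And>n. norm ((g ^^ n) z0) \<le> \<rho> n" and \<zeta>: "\<And>n. \<zeta> n \<in> \<Gamma>"
    "\<And>n. \<rho> n powr (2 ^ n * L) \<le> norm ((g ^^ n) (\<zeta> n))"
    by metis
  have r1: "1 < r" using RL(1) by (simp add: r_def)
  have "filterlim (\<lambda>n. r powr (2 ^ n * L)) at_top sequentially"
    using r1 RL(2) by real_asymp
  then have "filterlim (\<lambda>n. norm ((g ^^ n) (\<zeta> n))) at_top sequentially"
  proof (rule filterlim_at_top_mono, intro always_eventually allI)
    fix n
    have "r powr (2 ^ n * L) \<le> \<rho> n powr (2 ^ n * L)"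
      using \<rho>(1)[of n] r1 RL(2) by (intro powr_mono2) auto
    with \<zeta>(2)[of n] show "r powr (2 ^ n * L) \<le> norm ((g ^^ n) (\<zeta> n))" by linarith
  qed
  then obtain \<sigma> C where \<sigma>: "strict_mono (\<sigma> :: nat \<Rightarrow> nat)" and C: "0 < C" and
    ev: "\<forall>\<^sub>F n in sequentially. 1 < norm ((g ^^ \<sigma> n) z0) \<and>
       ln (norm ((g ^^ \<sigma> n) (\<zeta> (\<sigma> n)))) \<le> C * ln (norm ((g ^^ \<sigma> n) z0))"
    by (rule fatou_component_log_modulus_comparable[OF hol D \<Gamma>(1,3) z0 \<zeta>(1)])
  have lim: "filterlim (\<lambda>n. 2 ^ n * L) at_top sequentially"
    using RL(2) by real_asymp
  have "filterlim (\<lambda>n. 2 ^ \<sigma> n * L) at_top sequentially"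
    using filterlim_compose[OF lim filterlim_subseq[OF \<sigma>]] .
  then have "\<forall>\<^sub>F n in sequentially. C < 2 ^ \<sigma> n * L"
    by (simp add: filterlim_at_top_dense)
  with ev have "\<forall>\<^sub>F n in sequentially. False"
  proof eventually_elim
    case (elim n)
    define m where "m = \<sigma> n"
    have \<rho>m: "1 < \<rho> m" using \<rho>(1)[of m] r1 by linarith
    have "(2 ^ m * L) * ln (\<rho> m) = ln (\<rho> m powr (2 ^ m * L))" using \<rho>m by (simp add: ln_powr)
    also have "\<dots> \<le> ln (norm ((g ^^ m) (\<zeta> m)))"
      using \<zeta>(2)[of m] \<rho>m by (intro ln_mono) auto
    also have "\<dots> \<le> C * ln (norm ((g ^^ m) z0))" using elim(1) by (simp add: m_def)
    also have "\<dots> \<le> C * ln (\<rho> m)"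
      using elim(1) \<rho>(2)[of m] C by (intro mult_left_mono ln_mono) (auto simp: m_def)
    finally have "2 ^ m * L \<le> C" using \<rho>m by simp
    with elim(2) show ?case by (simp add: m_def)
  qed
  then show False by simp
qed

theorem corollary7p2:
  fixes k :: nat and f :: "nat \<Rightarrow> complex \<Rightarrow> complex" and g :: "complex \<Rightarrow> complex"
  assumes "k \<ge> 1"
    and "\<And>i. i \<in> {1..k} \<Longrightarrow> transcendental_entire (f i)"
    and "\<And>i. i \<in> {1..k} \<Longrightarrow> growth_order (f i) < ereal (1 / 2)"
    and "\<exists>j\<in>{1..k}. log_regular (f j)"
    and "g = foldr (\<circ>) (map f [1..<Suc k]) id"
  shows "\<forall>C \<in> components (Fatou_set g). bounded C"
proof -
  have hol: "f i holomorphic_on UNIV" if "i \<in> {1..k}" for i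
    using assms(2)[OF that] by (simp add: transcendental_entire_def)
  have fs: "h \<in> f ` {1..k}" if "h \<in> set (map f [1..<Suc k])" for h
    using that by (simp only: set_map set_upt atLeastLessThanSuc_atLeastAtMost)
  obtain j c where j: "j \<in> {1..k}" and c: "0 < c" "log_regular_with c (f j)"
    using assms(4) by (auto simp: log_regular_def)
  have mem: "f j \<in> set (map f [1..<Suc k])"
    using j by (simp only: set_map set_upt atLeastLessThanSuc_atLeastAtMost imageI)
  have "expands c g"
    unfolding assms(5)
    by (rule foldr_comp_expands[OF _ _ c(1) mem expands_log_regular[OF c(2) assms(3)[OF j]]])
      (use fs hol expands_0 assms(2,3) in blast)+
  moreover have "g holomorphic_on UNIV"
    unfolding assms(5) by (rule foldr_comp_holomorphic) (use fs hol in blast)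
  ultimately show ?thesis using expands_imp_Fatou_component_bounded c(1) by blast
qed

end
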